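(* For every formula $A$ of $\mathbf{IQC}$: $\vdash_{\mathbf{IQC}} A$ if and only if $\vdash_{\mathbf{EQC}} A^{\Box_{\mathbf{RS}}}$. Likewise, for every formula $A$ of the language of arithmetic: $\vdash_{\mathbf{HA}} A$ if and only if $\vdash_{\mathbf{EA}} A^{\Box_{\mathbf{RS}}}$.
   Context: $\mathbf{IQC}$ is intuitionistic first-order predicate calculus with equality, with primitives $\vee,\wedge,\supset,\exists,\forall$ and the constant $\bot$; $\neg A$ abbreviates $A\supset\bot$. $\mathbf{EQC}$ is classical first-order predicate calculus with equality extended by a modal operator $\Box$ governed by the S4 rules ($\Box$-introduction: from $A$ infer $\Box A$ provided all open assumptions have the form $\Box B$; $\Box$-elimination: from $\Box A$ infer $A$); no Barcan formula is assumed. $\mathbf{HA}$ is Heyting arithmetic (language $0,s,+,\cdot$; axioms for zero and successor, defining equations of $+,\cdot$, induction for all formulas) over $\mathbf{IQC}$. $\mathbf{EA}$ (Shapiro's epistemic arithmetic) is the same arithmetic axioms, with induction for all formulas of the modal language, over $\mathbf{EQC}$ (i.e. $\mathbf{PA}$ plus S4). The modified Rasiowa–Sikorski translation $A\mapsto A^{\Box_{\mathbf{RS}}}$ is defined by induction on $A$: (i) if $A$ is $\bot$ or an equation $s=t$, $A^{\Box_{\mathbf{RS}}}=A$; (ii) if $A$ is any other atomic formula, $A^{\Box_{\mathbf{RS}}}=\Box A$; (iii) $(A\vee B)^{\Box_{\mathbf{RS}}}=\Box A^{\Box_{\mathbf{RS}}}\vee\Box B^{\Box_{\mathbf{RS}}}$;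 (iv) $(A\wedge B)^{\Box_{\mathbf{RS}}}=A^{\Box_{\mathbf{RS}}}\wedge B^{\Box_{\mathbf{RS}}}$; (v) $(A\supset B)^{\Box_{\mathbf{RS}}}=\Box(\Box A^{\Box_{\mathbf{RS}}}\supset\Box B^{\Box_{\mathbf{RS}}})$; (vi) $(\exists x A)^{\Box_{\mathbf{RS}}}=\exists x\,\Box A^{\Box_{\mathbf{RS}}}$; (vii) $(\forall x A)^{\Box_{\mathbf{RS}}}=\forall x\,A^{\Box_{\mathbf{RS}}}$. *)

theory Defs
  imports Main
begin

section \<open>Languages, terms and formulas\<close>

text \<open>
  A language is given by the arities of its function and predicate symbols; a symbol mapped to
  \<open>None\<close> does not belong to it. Equality is a logical symbol. Variables are de Bruijn indices:
  an index that points beyond all enclosing quantifiers is a free variable (parameter).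
\<close>

record ('f, 'p) signature =
  funs :: "'f \<Rightarrow> nat option"
  preds :: "'p \<Rightarrow> nat option"

datatype 'f tm =
    Var nat
  | App 'f "'f tm list"

primrec subst_tm :: "(nat \<Rightarrow> 'f tm) \<Rightarrow> 'f tm \<Rightarrow> 'f tm" where
  "subst_tm \<sigma> (Var n) = \<sigma> n"
| "subst_tm \<sigma> (App f ts) = App f (map (subst_tm \<sigma>) ts)"

inductive wf_tm :: "('f, 'p) signature \<Rightarrow> 'f tm \<Rightarrow> bool" for \<Sigma> where
  "wf_tm \<Sigma> (Var n)"
| "funs \<Sigma> f = Some (length ts) \<Longrightarrow> (\<And>t. t \<in> set ts \<Longrightarrow> wf_tm \<Sigma> t) \<Longrightarrow> wf_tm \<Sigma> (App f ts)"

text \<open>Simultaneous substitutions: instantiation of the index 0 by a term, renaming of all free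
  variables to make room for a fresh index 0, and extension of a substitution under a quantifier.\<close>

definition inst :: "'f tm \<Rightarrow> nat \<Rightarrow> 'f tm" where
  "inst t = case_nat t Var"

definition shift :: "nat \<Rightarrow> 'f tm" where
  "shift n = Var (Suc n)"

definition up :: "(nat \<Rightarrow> 'f tm) \<Rightarrow> nat \<Rightarrow> 'f tm" where
  "up \<sigma> = case_nat (Var 0) (\<lambda>n. subst_tm shift (\<sigma> n))"

datatype ('f, 'p) fm =
    Fls
  | Eq "'f tm" "'f tm"
  | Pred 'p "'f tm list"
  | Dis "('f, 'p) fm" "('f, 'p) fm"
  | Con "('f, 'p) fm" "('f, 'p) fm"
  | Imp "('f, 'p) fm" "('f, 'p) fm"
  | Exi "('f, 'p) fm"
  | Uni "('f, 'p) fm"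

primrec subst :: "(nat \<Rightarrow> 'f tm) \<Rightarrow> ('f, 'p) fm \<Rightarrow> ('f, 'p) fm" where
  "subst \<sigma> Fls = Fls"
| "subst \<sigma> (Eq s t) = Eq (subst_tm \<sigma> s) (subst_tm \<sigma> t)"
| "subst \<sigma> (Pred p ts) = Pred p (map (subst_tm \<sigma>) ts)"
| "subst \<sigma> (Dis A B) = Dis (subst \<sigma> A) (subst \<sigma> B)"
| "subst \<sigma> (Con A B) = Con (subst \<sigma> A) (subst \<sigma> B)"
| "subst \<sigma> (Imp A B) = Imp (subst \<sigma> A) (subst \<sigma> B)"
| "subst \<sigma> (Exi A) = Exi (subst (up \<sigma>) A)"
| "subst \<sigma> (Uni A) = Uni (subst (up \<sigma>) A)"

primrec wf_fm :: "('f, 'p) signature \<Rightarrow> ('f, 'p) fm \<Rightarrow> bool" where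
  "wf_fm \<Sigma> Fls = True"
| "wf_fm \<Sigma> (Eq s t) = (wf_tm \<Sigma> s \<and> wf_tm \<Sigma> t)"
| "wf_fm \<Sigma> (Pred p ts) = (preds \<Sigma> p = Some (length ts) \<and> (\<forall>t\<in>set ts. wf_tm \<Sigma> t))"
| "wf_fm \<Sigma> (Dis A B) = (wf_fm \<Sigma> A \<and> wf_fm \<Sigma> B)"
| "wf_fm \<Sigma> (Con A B) = (wf_fm \<Sigma> A \<and> wf_fm \<Sigma> B)"
| "wf_fm \<Sigma> (Imp A B) = (wf_fm \<Sigma> A \<and> wf_fm \<Sigma> B)"
| "wf_fm \<Sigma> (Exi A) = wf_fm \<Sigma> A"
| "wf_fm \<Sigma> (Uni A) = wf_fm \<Sigma> A"

datatype ('f, 'p) mfm =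
    MFls
  | MEq "'f tm" "'f tm"
  | MPred 'p "'f tm list"
  | MDis "('f, 'p) mfm" "('f, 'p) mfm"
  | MCon "('f, 'p) mfm" "('f, 'p) mfm"
  | MImp "('f, 'p) mfm" "('f, 'p) mfm"
  | MExi "('f, 'p) mfm"
  | MUni "('f, 'p) mfm"
  | Box "('f, 'p) mfm"

primrec msubst :: "(nat \<Rightarrow> 'f tm) \<Rightarrow> ('f, 'p) mfm \<Rightarrow> ('f, 'p) mfm" where
  "msubst \<sigma> MFls = MFls"
| "msubst \<sigma> (MEq s t) = MEq (subst_tm \<sigma> s) (subst_tm \<sigma> t)"
| "msubst \<sigma> (MPred p ts) = MPred p (map (subst_tm \<sigma>) ts)"
| "msubst \<sigma> (MDis A B) = MDis (msubst \<sigma> A) (msubst \<sigma> B)"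
| "msubst \<sigma> (MCon A B) = MCon (msubst \<sigma> A) (msubst \<sigma> B)"
| "msubst \<sigma> (MImp A B) = MImp (msubst \<sigma> A) (msubst \<sigma> B)"
| "msubst \<sigma> (MExi A) = MExi (msubst (up \<sigma>) A)"
| "msubst \<sigma> (MUni A) = MUni (msubst (up \<sigma>) A)"
| "msubst \<sigma> (Box A) = Box (msubst \<sigma> A)"

primrec wf_mfm :: "('f, 'p) signature \<Rightarrow> ('f, 'p) mfm \<Rightarrow> bool" where
  "wf_mfm \<Sigma> MFls = True"
| "wf_mfm \<Sigma> (MEq s t) = (wf_tm \<Sigma> s \<and> wf_tm \<Sigma> t)"
| "wf_mfm \<Sigma> (MPred p ts) = (preds \<Sigma> p = Some (length ts) \<and> (\<forall>t\<in>set ts. wf_tm \<Sigma> t))"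
| "wf_mfm \<Sigma> (MDis A B) = (wf_mfm \<Sigma> A \<and> wf_mfm \<Sigma> B)"
| "wf_mfm \<Sigma> (MCon A B) = (wf_mfm \<Sigma> A \<and> wf_mfm \<Sigma> B)"
| "wf_mfm \<Sigma> (MImp A B) = (wf_mfm \<Sigma> A \<and> wf_mfm \<Sigma> B)"
| "wf_mfm \<Sigma> (MExi A) = wf_mfm \<Sigma> A"
| "wf_mfm \<Sigma> (MUni A) = wf_mfm \<Sigma> A"
| "wf_mfm \<Sigma> (Box A) = wf_mfm \<Sigma> A"

abbreviation Neg :: "('f, 'p) fm \<Rightarrow> ('f, 'p) fm" where
  "Neg A \<equiv> Imp A Fls"

abbreviation MNeg :: "('f, 'p) mfm \<Rightarrow> ('f, 'p) mfm" where
  "MNeg A \<equiv> MImp A MFls"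

section \<open>Natural deduction\<close>

text \<open>
  In \<open>iprov \<Sigma> T \<Gamma> A\<close> and \<open>eprov \<Sigma> T \<Gamma> A\<close> the set \<open>T\<close> contains nonlogical axioms and \<open>\<Gamma>\<close> contains the
  formulas that may be used as open assumptions. Axioms are not open assumptions: they do not
  restrict the eigenvariable conditions or the introduction of \<open>Box\<close>. The well-formedness
  premises confine derivations to the language \<open>\<Sigma>\<close>.
\<close>

inductive iprov ::
  "('f, 'p) signature \<Rightarrow> ('f, 'p) fm set \<Rightarrow> ('f, 'p) fm set \<Rightarrow> ('f, 'p) fm \<Rightarrow> bool"
  for \<Sigma> T where
  iAx: "A \<in> T \<Longrightarrow> wf_fm \<Sigma> A \<Longrightarrow> iprov \<Sigma> T \<Gamma> A"
| iAssm: "A \<in> \<Gamma> \<Longrightarrow> wf_fm \<Sigma> A \<Longrightarrow> iprov \<Sigma> T \<Gamma> A"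
| iFlsE: "iprov \<Sigma> T \<Gamma> Fls \<Longrightarrow> wf_fm \<Sigma> A \<Longrightarrow> iprov \<Sigma> T \<Gamma> A"
| iConI: "iprov \<Sigma> T \<Gamma> A \<Longrightarrow> iprov \<Sigma> T \<Gamma> B \<Longrightarrow> iprov \<Sigma> T \<Gamma> (Con A B)"
| iConE1: "iprov \<Sigma> T \<Gamma> (Con A B) \<Longrightarrow> iprov \<Sigma> T \<Gamma> A"
| iConE2: "iprov \<Sigma> T \<Gamma> (Con A B) \<Longrightarrow> iprov \<Sigma> T \<Gamma> B"
| iDisI1: "iprov \<Sigma> T \<Gamma> A \<Longrightarrow> wf_fm \<Sigma> B \<Longrightarrow> iprov \<Sigma> T \<Gamma> (Dis A B)"
| iDisI2: "iprov \<Sigma> T \<Gamma> B \<Longrightarrow> wf_fm \<Sigma> A \<Longrightarrow> iprov \<Sigma> T \<Gamma> (Dis A B)"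
| iDisE: "iprov \<Sigma> T \<Gamma> (Dis A B) \<Longrightarrow> iprov \<Sigma> T (insert A \<Gamma>) C \<Longrightarrow> iprov \<Sigma> T (insert B \<Gamma>) C
    \<Longrightarrow> iprov \<Sigma> T \<Gamma> C"
| iImpI: "wf_fm \<Sigma> A \<Longrightarrow> iprov \<Sigma> T (insert A \<Gamma>) B \<Longrightarrow> iprov \<Sigma> T \<Gamma> (Imp A B)"
| iImpE: "iprov \<Sigma> T \<Gamma> (Imp A B) \<Longrightarrow> iprov \<Sigma> T \<Gamma> A \<Longrightarrow> iprov \<Sigma> T \<Gamma> B"
| iUniI: "iprov \<Sigma> T (subst shift ` \<Gamma>) A \<Longrightarrow> iprov \<Sigma> T \<Gamma> (Uni A)"
| iUniE: "iprov \<Sigma> T \<Gamma> (Uni A) \<Longrightarrow> wf_tm \<Sigma> t \<Longrightarrow> iprov \<Sigma> T \<Gamma> (subst (inst t) A)"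
| iExiI: "wf_fm \<Sigma> A \<Longrightarrow> wf_tm \<Sigma> t \<Longrightarrow> iprov \<Sigma> T \<Gamma> (subst (inst t) A) \<Longrightarrow> iprov \<Sigma> T \<Gamma> (Exi A)"
| iExiE: "iprov \<Sigma> T \<Gamma> (Exi A) \<Longrightarrow> iprov \<Sigma> T (insert A (subst shift ` \<Gamma>)) (subst shift C)
    \<Longrightarrow> iprov \<Sigma> T \<Gamma> C"
| iEqI: "wf_tm \<Sigma> t \<Longrightarrow> iprov \<Sigma> T \<Gamma> (Eq t t)"
| iEqE: "wf_fm \<Sigma> A \<Longrightarrow> iprov \<Sigma> T \<Gamma> (Eq s t) \<Longrightarrow> iprov \<Sigma> T \<Gamma> (subst (inst s) A)
    \<Longrightarrow> iprov \<Sigma> T \<Gamma> (subst (inst t) A)"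

text \<open>In \<open>eBoxI\<close>, \<open>\<Delta>\<close> collects the assumptions that the derivation of \<open>A\<close> actually leaves open.
  In \<open>eEqE\<close>, as in induction below, \<open>A\<close> ranges over all modal formulas.\<close>

inductive eprov ::
  "('f, 'p) signature \<Rightarrow> ('f, 'p) mfm set \<Rightarrow> ('f, 'p) mfm set \<Rightarrow> ('f, 'p) mfm \<Rightarrow> bool"
  for \<Sigma> T where
  eAx: "A \<in> T \<Longrightarrow> wf_mfm \<Sigma> A \<Longrightarrow> eprov \<Sigma> T \<Gamma> A"
| eAssm: "A \<in> \<Gamma> \<Longrightarrow> wf_mfm \<Sigma> A \<Longrightarrow> eprov \<Sigma> T \<Gamma> A"
| eClass: "wf_mfm \<Sigma> A \<Longrightarrow> eprov \<Sigma> T (insert (MNeg A) \<Gamma>) MFls \<Longrightarrow> eprov \<Sigma> T \<Gamma> A"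
| eConI: "eprov \<Sigma> T \<Gamma> A \<Longrightarrow> eprov \<Sigma> T \<Gamma> B \<Longrightarrow> eprov \<Sigma> T \<Gamma> (MCon A B)"
| eConE1: "eprov \<Sigma> T \<Gamma> (MCon A B) \<Longrightarrow> eprov \<Sigma> T \<Gamma> A"
| eConE2: "eprov \<Sigma> T \<Gamma> (MCon A B) \<Longrightarrow> eprov \<Sigma> T \<Gamma> B"
| eDisI1: "eprov \<Sigma> T \<Gamma> A \<Longrightarrow> wf_mfm \<Sigma> B \<Longrightarrow> eprov \<Sigma> T \<Gamma> (MDis A B)"
| eDisI2: "eprov \<Sigma> T \<Gamma> B \<Longrightarrow> wf_mfm \<Sigma> A \<Longrightarrow> eprov \<Sigma> T \<Gamma> (MDis A B)"
| eDisE: "eprov \<Sigma> T \<Gamma> (MDis A B) \<Longrightarrow> eprov \<Sigma> T (insert A \<Gamma>) C \<Longrightarrow> eprov \<Sigma> T (insert B \<Gamma>) C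
    \<Longrightarrow> eprov \<Sigma> T \<Gamma> C"
| eImpI: "wf_mfm \<Sigma> A \<Longrightarrow> eprov \<Sigma> T (insert A \<Gamma>) B \<Longrightarrow> eprov \<Sigma> T \<Gamma> (MImp A B)"
| eImpE: "eprov \<Sigma> T \<Gamma> (MImp A B) \<Longrightarrow> eprov \<Sigma> T \<Gamma> A \<Longrightarrow> eprov \<Sigma> T \<Gamma> B"
| eUniI: "eprov \<Sigma> T (msubst shift ` \<Gamma>) A \<Longrightarrow> eprov \<Sigma> T \<Gamma> (MUni A)"
| eUniE: "eprov \<Sigma> T \<Gamma> (MUni A) \<Longrightarrow> wf_tm \<Sigma> t \<Longrightarrow> eprov \<Sigma> T \<Gamma> (msubst (inst t) A)"
| eExiI: "wf_mfm \<Sigma> A \<Longrightarrow> wf_tm \<Sigma> t \<Longrightarrow> eprov \<Sigma> T \<Gamma> (msubst (inst t) A) \<Longrightarrow> eprov \<Sigma> T \<Gamma> (MExi A)"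
| eExiE: "eprov \<Sigma> T \<Gamma> (MExi A) \<Longrightarrow> eprov \<Sigma> T (insert A (msubst shift ` \<Gamma>)) (msubst shift C)
    \<Longrightarrow> eprov \<Sigma> T \<Gamma> C"
| eEqI: "wf_tm \<Sigma> t \<Longrightarrow> eprov \<Sigma> T \<Gamma> (MEq t t)"
| eEqE: "wf_mfm \<Sigma> A \<Longrightarrow> eprov \<Sigma> T \<Gamma> (MEq s t) \<Longrightarrow> eprov \<Sigma> T \<Gamma> (msubst (inst s) A)
    \<Longrightarrow> eprov \<Sigma> T \<Gamma> (msubst (inst t) A)"
| eBoxI: "\<Delta> \<subseteq> \<Gamma> \<Longrightarrow> \<Delta> \<subseteq> range Box \<Longrightarrow> eprov \<Sigma> T \<Delta> A \<Longrightarrow> eprov \<Sigma> T \<Gamma> (Box A)"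
| eBoxE: "eprov \<Sigma> T \<Gamma> (Box A) \<Longrightarrow> eprov \<Sigma> T \<Gamma> A"

definition IQC :: "('f, 'p) signature \<Rightarrow> ('f, 'p) fm \<Rightarrow> bool" where
  "IQC \<Sigma> A \<longleftrightarrow> iprov \<Sigma> {} {} A"

definition EQC :: "('f, 'p) signature \<Rightarrow> ('f, 'p) mfm \<Rightarrow> bool" where
  "EQC \<Sigma> A \<longleftrightarrow> eprov \<Sigma> {} {} A"

section \<open>Arithmetic\<close>

datatype arith_fun = Zero | Succ | Plus | Times

text \<open>There are no predicate symbols besides equality; \<open>unit\<close> merely fills the type argument.\<close>

definition arith :: "(arith_fun, unit) signature" where
  "arith = \<lparr> funs = (\<lambda>f. Some (case f of Zero \<Rightarrow> 0 | Succ \<Rightarrow> 1 | Plus \<Rightarrow> 2 | Times \<Rightarrow> 2)),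
             preds = (\<lambda>_. None) \<rparr>"

abbreviation zero_tm :: "arith_fun tm" where
  "zero_tm \<equiv> App Zero []"

abbreviation succ_tm :: "arith_fun tm \<Rightarrow> arith_fun tm" where
  "succ_tm t \<equiv> App Succ [t]"

abbreviation plus_tm :: "arith_fun tm \<Rightarrow> arith_fun tm \<Rightarrow> arith_fun tm" where
  "plus_tm s t \<equiv> App Plus [s, t]"

abbreviation times_tm :: "arith_fun tm \<Rightarrow> arith_fun tm \<Rightarrow> arith_fun tm" where
  "times_tm s t \<equiv> App Times [s, t]"

text \<open>Replaces the variable 0 by its successor and keeps all other variables.\<close>

definition step :: "nat \<Rightarrow> arith_fun tm" where
  "step = case_nat (succ_tm (Var 0)) (\<lambda>n. Var (Suc n))"

inductive_set HA_axioms :: "(arith_fun, unit) fm set" where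
  "Uni (Neg (Eq (succ_tm (Var 0)) zero_tm)) \<in> HA_axioms"
| "Uni (Uni (Imp (Eq (succ_tm (Var 1)) (succ_tm (Var 0))) (Eq (Var 1) (Var 0)))) \<in> HA_axioms"
| "Uni (Eq (plus_tm (Var 0) zero_tm) (Var 0)) \<in> HA_axioms"
| "Uni (Uni (Eq (plus_tm (Var 1) (succ_tm (Var 0))) (succ_tm (plus_tm (Var 1) (Var 0)))))
    \<in> HA_axioms"
| "Uni (Eq (times_tm (Var 0) zero_tm) zero_tm) \<in> HA_axioms"
| "Uni (Uni (Eq (times_tm (Var 1) (succ_tm (Var 0))) (plus_tm (times_tm (Var 1) (Var 0)) (Var 1))))
    \<in> HA_axioms"
| "wf_fm arith A \<Longrightarrow>
    Imp (Con (subst (inst zero_tm) A) (Uni (Imp A (subst step A)))) (Uni A) \<in> HA_axioms"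

inductive_set EA_axioms :: "(arith_fun, unit) mfm set" where
  "MUni (MNeg (MEq (succ_tm (Var 0)) zero_tm)) \<in> EA_axioms"
| "MUni (MUni (MImp (MEq (succ_tm (Var 1)) (succ_tm (Var 0))) (MEq (Var 1) (Var 0)))) \<in> EA_axioms"
| "MUni (MEq (plus_tm (Var 0) zero_tm) (Var 0)) \<in> EA_axioms"
| "MUni (MUni (MEq (plus_tm (Var 1) (succ_tm (Var 0))) (succ_tm (plus_tm (Var 1) (Var 0)))))
    \<in> EA_axioms"
| "MUni (MEq (times_tm (Var 0) zero_tm) zero_tm) \<in> EA_axioms"
| "MUni (MUni (MEq (times_tm (Var 1) (succ_tm (Var 0))) (plus_tm (times_tm (Var 1) (Var 0)) (Var 1))))
    \<in> EA_axioms"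
| "wf_mfm arith A \<Longrightarrow>
    MImp (MCon (msubst (inst zero_tm) A) (MUni (MImp A (msubst step A)))) (MUni A) \<in> EA_axioms"

definition HA :: "(arith_fun, unit) fm \<Rightarrow> bool" where
  "HA A \<longleftrightarrow> iprov arith HA_axioms {} A"

definition EA :: "(arith_fun, unit) mfm \<Rightarrow> bool" where
  "EA A \<longleftrightarrow> eprov arith EA_axioms {} A"

section \<open>The modified Rasiowa--Sikorski translation\<close>

primrec rs :: "('f, 'p) fm \<Rightarrow> ('f, 'p) mfm" where
  "rs Fls = MFls"
| "rs (Eq s t) = MEq s t"
| "rs (Pred p ts) = Box (MPred p ts)"
| "rs (Dis A B) = MDis (Box (rs A)) (Box (rs B))"
| "rs (Con A B) = MCon (rs A) (rs B)"
| "rs (Imp A B) = Box (MImp (Box (rs A)) (Box (rs B)))"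
| "rs (Exi A) = MExi (Box (rs A))"
| "rs (Uni A) = MUni (rs A)"

end

theory Submission
  imports Defs
begin

text \<open>
  That derivability of \<open>A\<close> implies derivability of \<open>rs A\<close> is a rule induction, with every assumption
  boxed. For the converse, in the style of Flagg and Friedman, modal derivations are interpreted in the
  intuitionistic system. Let \<open>L\<close> consist of \<open>Fls\<close> and the subformulas of \<open>A\<close>; the instances of the
  members of \<open>L\<close> serve as possible worlds. A modal formula is interpreted at the world \<open>E\<close> by
  the double-negation translation with \<open>Fls\<close> replaced by \<open>E\<close>, which makes classical logic sound, and
  \<open>Box B\<close> says, up to this double negation, that \<open>B\<close> holds at all worlds. Since \<open>L\<close> is
  finite, this is expressed by a formula, so that induction for modal formulas becomes induction for
  ordinary ones. For every subformula \<open>C\<close> of \<open>A\<close>, the formula \<open>rs C\<close> holds at all worlds iff \<open>C\<close> holds: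
  evaluating at the world \<open>C\<close> turns \<open>(C \<longrightarrow> C) \<longrightarrow> C\<close> into \<open>C\<close>.
\<close>

section \<open>Substitution and well-formedness\<close>

lemma subst_tm_comp: "subst_tm \<sigma> (subst_tm \<rho> t) = subst_tm (subst_tm \<sigma> \<circ> \<rho>) t"
  by (induction t) auto

lemma subst_tm_o_assoc:
  "subst_tm (subst_tm \<sigma> \<circ> \<rho>) \<circ> \<tau> = subst_tm \<sigma> \<circ> (subst_tm \<rho> \<circ> \<tau>)"
  by (simp add: fun_eq_iff subst_tm_comp)

lemma subst_tm_Var: "subst_tm Var t = t"
  by (induction t) (auto intro: map_idI)

lemma subst_tm_shift_up: "subst_tm (up \<sigma>) \<circ> shift = subst_tm shift \<circ> \<sigma>"
  by (auto simp: up_def shift_def fun_eq_iff)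

lemma up_Var: "up Var = Var"
  by (auto simp: up_def shift_def fun_eq_iff split: nat.split)

lemma up_comp: "subst_tm (up \<sigma>) \<circ> up \<rho> = up (subst_tm \<sigma> \<circ> \<rho>)"
proof
  fix i show "(subst_tm (up \<sigma>) \<circ> up \<rho>) i = up (subst_tm \<sigma> \<circ> \<rho>) i"
    by (cases i) (simp_all add: up_def subst_tm_comp subst_tm_shift_up [unfolded up_def])
qed

lemma subst_comp: "subst \<sigma> (subst \<rho> A) = subst (subst_tm \<sigma> \<circ> \<rho>) A"
  by (induction A arbitrary: \<sigma> \<rho>) (auto simp: subst_tm_comp up_comp)

lemma msubst_comp: "msubst \<sigma> (msubst \<rho> A) = msubst (subst_tm \<sigma> \<circ> \<rho>) A"
  by (induction A arbitrary: \<sigma> \<rho>) (auto simp: subst_tm_comp up_comp)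

lemma subst_Var: "subst Var A = A"
  by (induction A) (auto simp: subst_tm_Var up_Var intro: map_idI)

lemma msubst_Var: "msubst Var A = A"
  by (induction A) (auto simp: subst_tm_Var up_Var intro: map_idI)

text \<open>\<open>case_nat\<close> is the normal form of an instantiation: together with
  \<open>comp_inst\<close> this turns the exchange of instantiation and substitution into an
  identity of composed maps.\<close>

lemma inst_up: "subst_tm (inst t) \<circ> up \<sigma> = case_nat t \<sigma>"
proof
  have "subst_tm (inst t) \<circ> shift = Var"
    by (auto simp: inst_def shift_def)
  then show "(subst_tm (inst t) \<circ> up \<sigma>) i = case_nat t \<sigma> i" for i
    by (cases i) (simp_all add: up_def subst_tm_comp subst_tm_Var, simp add: inst_def)
qed

lemma inst_shift: "subst_tm (inst t) \<circ> shift = Var"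
  by (auto simp: inst_def shift_def)

lemma inst_Var0_up_shift: "subst_tm (inst (Var 0)) \<circ> up shift = Var"
  unfolding inst_up by (auto simp: shift_def fun_eq_iff split: nat.split)

lemma comp_inst: "subst_tm \<sigma> \<circ> inst t = case_nat (subst_tm \<sigma> t) \<sigma>"
  by (auto simp: inst_def fun_eq_iff split: nat.split)

lemma step_shift: "subst_tm step \<circ> shift = shift"
  by (auto simp: step_def shift_def)

text \<open>\<open>step\<close> changes index 0 only; \<open>up \<sigma>\<close> fixes that index
  and sends the others to terms that avoid it. Hence the interpretation of an induction axiom will
  again be an induction axiom.\<close>

lemma comp_step: "subst_tm (up \<sigma>) \<circ> step = subst_tm step \<circ> up \<sigma>"
proof
  show "(subst_tm (up \<sigma>) \<circ> step) i = (subst_tm step \<circ> up \<sigma>) i" for i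
    by (cases i) (simp_all add: step_def up_def subst_tm_comp step_shift [unfolded step_def])
qed

lemma wf_tm_App [simp]:
  "wf_tm \<Sigma> (App f ts) \<longleftrightarrow> funs \<Sigma> f = Some (length ts) \<and> (\<forall>t\<in>set ts. wf_tm \<Sigma> t)"
  by (auto elim: wf_tm.cases intro: wf_tm.intros)

lemma wf_tm_Var [simp]: "wf_tm \<Sigma> (Var i)"
  by (rule wf_tm.intros)

lemma wf_subst_tm: "wf_tm \<Sigma> t \<Longrightarrow> (\<And>i. wf_tm \<Sigma> (\<sigma> i)) \<Longrightarrow> wf_tm \<Sigma> (subst_tm \<sigma> t)"
  by (induction t) auto

lemma wf_subst_tmD: "wf_tm \<Sigma> (subst_tm \<sigma> t) \<Longrightarrow> wf_tm \<Sigma> t"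
  by (induction t) auto

lemma wf_shift: "wf_tm \<Sigma> (shift i)"
  by (simp add: shift_def)

lemma wf_up: "(\<And>i. wf_tm \<Sigma> (\<sigma> i)) \<Longrightarrow> wf_tm \<Sigma> (up \<sigma> i)"
  by (cases i) (auto simp: up_def intro: wf_subst_tm wf_shift)

lemma wf_inst: "wf_tm \<Sigma> t \<Longrightarrow> wf_tm \<Sigma> (inst t i)"
  by (cases i) (auto simp: inst_def)

lemma wf_subst: "wf_fm \<Sigma> A \<Longrightarrow> (\<And>i. wf_tm \<Sigma> (\<sigma> i)) \<Longrightarrow> wf_fm \<Sigma> (subst \<sigma> A)"
  by (induction A arbitrary: \<sigma>) (auto intro: wf_subst_tm wf_up)

text \<open>Every symbol of \<open>A\<close> survives in the instance, so nothing is asked of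
  \<open>\<sigma>\<close>. The rule \<open>iExiE\<close> calls for this direction, since its premise
  shows only the shifted conclusion.\<close>

lemma wf_substD: "wf_fm \<Sigma> (subst \<sigma> A) \<Longrightarrow> wf_fm \<Sigma> A"
  by (induction A arbitrary: \<sigma>) (auto dest: wf_subst_tmD)

lemma wf_msubst: "wf_mfm \<Sigma> A \<Longrightarrow> (\<And>i. wf_tm \<Sigma> (\<sigma> i)) \<Longrightarrow> wf_mfm \<Sigma> (msubst \<sigma> A)"
  by (induction A arbitrary: \<sigma>) (auto intro: wf_subst_tm wf_up)

lemma wf_msubstD: "wf_mfm \<Sigma> (msubst \<sigma> A) \<Longrightarrow> wf_mfm \<Sigma> A"
  by (induction A arbitrary: \<sigma>) (auto dest: wf_subst_tmD)

section \<open>Structural properties of derivations\<close>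

lemma iprov_wf: "iprov \<Sigma> T \<Gamma> A \<Longrightarrow> wf_fm \<Sigma> A"
  by (induction rule: iprov.induct) (auto intro: wf_subst wf_inst dest: wf_substD)

lemma eprov_wf: "eprov \<Sigma> T \<Gamma> A \<Longrightarrow> wf_mfm \<Sigma> A"
  by (induction rule: eprov.induct) (auto intro: wf_msubst wf_inst dest: wf_msubstD)

lemma iprov_mono: "iprov \<Sigma> T \<Gamma> A \<Longrightarrow> \<Gamma> \<subseteq> \<Gamma>' \<Longrightarrow> iprov \<Sigma> T \<Gamma>' A"
proof (induction arbitrary: \<Gamma>' rule: iprov.induct)
  case (iDisE \<Gamma> A B C)
  then show ?case by (meson iprov.iDisE insert_mono)
next
  case (iImpI A \<Gamma> B)
  then show ?case by (meson iprov.iImpI insert_mono)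
next
  case (iUniI \<Gamma> A)
  then show ?case by (meson iprov.iUniI image_mono)
next
  case (iExiE \<Gamma> A C)
  then show ?case by (meson iprov.iExiE insert_mono image_mono)
next
  case (iEqE A \<Gamma> s t)
  then show ?case by (meson iprov.iEqE)
qed (auto intro: iprov.intros)

text \<open>Weakening by unboxed formulas passes through \<open>eBoxI\<close> because that rule
  keeps its own context \<open>\<Delta>\<close> inside the larger one.\<close>

lemma eprov_mono: "eprov \<Sigma> T \<Gamma> A \<Longrightarrow> \<Gamma> \<subseteq> \<Gamma>' \<Longrightarrow> eprov \<Sigma> T \<Gamma>' A"
proof (induction arbitrary: \<Gamma>' rule: eprov.induct)
  case (eClass A \<Gamma>)
  then show ?case by (meson eprov.eClass insert_mono)
next
  case (eDisE \<Gamma> A B C)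
  then show ?case by (meson eprov.eDisE insert_mono)
next
  case (eImpI A \<Gamma> B)
  then show ?case by (meson eprov.eImpI insert_mono)
next
  case (eUniI \<Gamma> A)
  then show ?case by (meson eprov.eUniI image_mono)
next
  case (eExiE \<Gamma> A C)
  then show ?case by (meson eprov.eExiE insert_mono image_mono)
next
  case (eEqE A \<Gamma> s t)
  then show ?case by (meson eprov.eEqE)
next
  case (eBoxI \<Delta> \<Gamma> A)
  then show ?case by (meson eprov.eBoxI subset_trans)
qed (auto intro: eprov.intros)

lemma iprov_insert: "iprov \<Sigma> T \<Gamma> A \<Longrightarrow> iprov \<Sigma> T (insert B \<Gamma>) A"
  by (erule iprov_mono) auto

lemma iprov_hyp: "wf_fm \<Sigma> A \<Longrightarrow> iprov \<Sigma> T (insert A \<Gamma>) A"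
  by (rule iAssm) auto

lemma iprov_cut: "iprov \<Sigma> T \<Gamma> A \<Longrightarrow> iprov \<Sigma> T (insert A \<Gamma>) B \<Longrightarrow> iprov \<Sigma> T \<Gamma> B"
  by (meson iprov_wf iImpI iImpE)

lemma iprov_cut_finite:
  assumes "finite \<Delta>" and "iprov \<Sigma> T \<Delta> A" and "\<And>B. B \<in> \<Delta> \<Longrightarrow> iprov \<Sigma> T \<Gamma> B"
  shows "iprov \<Sigma> T \<Gamma> A"
proof -
  have "iprov \<Sigma> T (\<Delta> \<union> \<Gamma>) A"
    using assms(2) by (rule iprov_mono) simp
  with assms(1,3) show ?thesis
  proof (induction \<Delta>)
    case (insert B \<Delta>)
    have "iprov \<Sigma> T (\<Delta> \<union> \<Gamma>) B"
      by (rule iprov_mono [OF insert.prems(1)]) simp_all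
    with insert.prems(2) have "iprov \<Sigma> T (\<Delta> \<union> \<Gamma>) A"
      by simp (rule iprov_cut)
    with insert show ?case by simp
  qed simp
qed

text \<open>The witness is the eigenvariable \<open>Var 0\<close>: lifting the body by
  \<open>up shift\<close> and instantiating it with \<open>Var 0\<close> cancel.\<close>

lemma iprov_ExiI_Var0:
  assumes "iprov \<Sigma> T \<Gamma> A"
  shows "iprov \<Sigma> T \<Gamma> (subst shift (Exi A))"
proof -
  have "wf_fm \<Sigma> (subst (up shift) A)"
    using assms by (auto dest: iprov_wf intro: wf_subst wf_up wf_shift)
  then show ?thesis
    using assms iExiI [where t = "Var 0" and A = "subst (up shift) A"]
    by (simp add: subst_comp inst_Var0_up_shift subst_Var)
qed

lemma iprov_UniE_Var0: "iprov \<Sigma> T \<Gamma> (subst shift (Uni A)) \<Longrightarrow> iprov \<Sigma> T \<Gamma> A"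
  using iUniE [where t = "Var 0" and A = "subst (up shift) A"]
  by (simp add: subst_comp inst_Var0_up_shift subst_Var)

lemma eprov_hyp: "wf_mfm \<Sigma> A \<Longrightarrow> eprov \<Sigma> T (insert A \<Gamma>) A"
  by (rule eAssm) auto

lemma eprov_MFlsE: "eprov \<Sigma> T \<Gamma> MFls \<Longrightarrow> wf_mfm \<Sigma> A \<Longrightarrow> eprov \<Sigma> T \<Gamma> A"
  by (rule eClass) (auto intro: eprov_mono)

lemma eprov_UniE_Var0: "eprov \<Sigma> T \<Gamma> (msubst shift (MUni A)) \<Longrightarrow> eprov \<Sigma> T \<Gamma> A"
  using eUniE [where t = "Var 0" and A = "msubst (up shift) A"]
  by (simp add: msubst_comp inst_Var0_up_shift msubst_Var)

lemma eprov_BoxI_image: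
  "eprov \<Sigma> T ((\<lambda>B. Box (f B)) ` \<Gamma>) A \<Longrightarrow> eprov \<Sigma> T ((\<lambda>B. Box (f B)) ` \<Gamma>) (Box A)"
  by (rule eBoxI) auto

lemma eprov_BoxI_Box: "eprov \<Sigma> T {Box A} B \<Longrightarrow> eprov \<Sigma> T {Box A} (Box B)"
  by (rule eBoxI) auto

lemma eprov_BoxI_empty: "eprov \<Sigma> T {} A \<Longrightarrow> eprov \<Sigma> T \<Gamma> (Box A)"
  by (rule eBoxI) auto

text \<open>The implication is proved first, with its antecedent as an assumption that can be
  shifted. This avoids transporting the given derivation over \<open>\<Gamma>\<close> to the shifted
  context of \<open>eUniI\<close>.\<close>

lemma eprov_MUni_BoxE:
  assumes "eprov \<Sigma> T \<Gamma> (MUni (Box A))"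
  shows "eprov \<Sigma> T \<Gamma> (MUni A)"
proof -
  have wf: "wf_mfm \<Sigma> A"
    using eprov_wf [OF assms] by simp
  have "eprov \<Sigma> T {MUni (Box (msubst (up shift) A))} (msubst shift (MUni (Box A)))"
    by (simp, intro eprov_hyp) (auto intro: wf wf_msubst wf_up wf_shift)
  then have "eprov \<Sigma> T (msubst shift ` insert (MUni (Box A)) \<Gamma>) A"
    by (rule eBoxE [OF eprov_UniE_Var0, OF eprov_mono]) auto
  then have "eprov \<Sigma> T \<Gamma> (MImp (MUni (Box A)) (MUni A))"
    using wf by (intro eImpI eUniI) auto
  then show ?thesis
    using assms by (rule eImpE)
qed

section \<open>Soundness of the translation\<close>

lemma rs_subst: "rs (subst \<sigma> A) = msubst \<sigma> (rs A)"
  by (induction A arbitrary: \<sigma>) auto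

lemma wf_rs: "wf_fm \<Sigma> A \<Longrightarrow> wf_mfm \<Sigma> (rs A)"
  by (induction A) auto

text \<open>Since all assumptions are boxed, \<open>eBoxI\<close> turns \<open>rs A\<close> into
  \<open>Box (rs A)\<close> wherever the clauses for disjunction, implication and existence ask for
  it.\<close>

lemma rs_sound:
  assumes ax: "\<And>A. A \<in> T \<Longrightarrow> wf_fm \<Sigma> A \<Longrightarrow> eprov \<Sigma> T' {} (rs A)"
    and "iprov \<Sigma> T \<Gamma> A"
  shows "eprov \<Sigma> T' ((\<lambda>B. Box (rs B)) ` \<Gamma>) (rs A)"
  using assms(2)
proof (induction rule: iprov.induct)
  case (iAx A \<Gamma>)
  from ax [OF iAx] show ?case by (rule eprov_mono) simp
next
  case (iAssm A \<Gamma>)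
  then show ?case by (simp add: eBoxE [OF eAssm] wf_rs)
next
  case (iFlsE \<Gamma> A)
  then show ?case by (simp add: eprov_MFlsE wf_rs)
next
  case (iDisI1 \<Gamma> A B)
  then show ?case by (simp only: rs.simps) (intro eDisI1 eprov_BoxI_image, simp_all add: wf_rs)
next
  case (iDisI2 \<Gamma> B A)
  then show ?case by (simp only: rs.simps) (intro eDisI2 eprov_BoxI_image, simp_all add: wf_rs)
next
  case (iDisE \<Gamma> A B C)
  then show ?case by (simp only: rs.simps image_insert) (rule eDisE)
next
  case (iImpI A \<Gamma> B)
  then have "eprov \<Sigma> T' ((\<lambda>B. Box (rs B)) ` insert A \<Gamma>) (Box (rs B))"
    by (intro eprov_BoxI_image)
  with iImpI show ?case
    by (simp only: rs.simps image_insert) (intro eprov_BoxI_image eImpI, simp_all add: wf_rs)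
next
  case (iImpE \<Gamma> A B)
  then have "eprov \<Sigma> T' ((\<lambda>B. Box (rs B)) ` \<Gamma>) (MImp (Box (rs A)) (Box (rs B)))"
    by (simp only: rs.simps) (rule eBoxE)
  then show ?case using iImpE.IH(2) by (rule eBoxE [OF eImpE [OF _ eprov_BoxI_image]])
next
  case (iUniI \<Gamma> A)
  then show ?case by (intro eUniI [where A = "rs A", folded rs.simps]) (simp add: image_image rs_subst)
next
  case (iUniE \<Gamma> A t)
  then show ?case by (simp only: rs_subst rs.simps) (rule eUniE)
next
  case (iExiI A t \<Gamma>)
  then have "eprov \<Sigma> T' ((\<lambda>B. Box (rs B)) ` \<Gamma>) (msubst (inst t) (Box (rs A)))"
    by (simp only: rs_subst msubst.simps) (rule eprov_BoxI_image)
  with iExiI show ?case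
    by (simp only: rs.simps) (intro eExiI [where t = t], simp_all add: wf_rs)
next
  case (iExiE \<Gamma> A C)
  then show ?case
    by (intro eExiE [where A = "Box (rs A)" and C = "rs C"]) (simp_all add: image_image rs_subst)
next
  case (iEqE A \<Gamma> s t)
  then show ?case by (simp only: rs_subst rs.simps) (rule eEqE [OF wf_rs])
next
  case (iConE1 \<Gamma> A B)
  then show ?case by (simp only: rs.simps) (rule eConE1)
next
  case (iConE2 \<Gamma> A B)
  then show ?case by (simp only: rs.simps) (rule eConE2)
next
  case (iConI \<Gamma> A B)
  then show ?case by (simp only: rs.simps) (rule eConI)
next
  case (iEqI t \<Gamma>)
  then show ?case by (simp only: rs.simps) (rule eEqI)
qed

text \<open>Provability from no assumptions allows necessitation of the whole implication, and the
  single assumption \<open>Box (rs A)\<close> allows it again for the consequent.\<close>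

lemma eprov_rs_Imp:
  assumes "eprov \<Sigma> T {} (MImp (rs A) (rs B))"
  shows "eprov \<Sigma> T \<Gamma> (rs (Imp A B))"
proof -
  have wf: "wf_mfm \<Sigma> (rs A)"
    using eprov_wf [OF assms] by simp
  have "eprov \<Sigma> T {Box (rs A)} (MImp (rs A) (rs B))"
    using assms by (rule eprov_mono) simp
  moreover have "eprov \<Sigma> T {Box (rs A)} (rs A)"
    by (rule eBoxE [OF eprov_hyp]) (simp add: wf)
  ultimately have "eprov \<Sigma> T {Box (rs A)} (rs B)"
    by (rule eImpE)
  then show ?thesis
    using wf by (simp only: rs.simps) (intro eprov_BoxI_empty eImpI eprov_BoxI_Box, simp_all)
qed

text \<open>The purely equational axioms are their own translations; the two successor axioms with
  an implication are necessitated. Only induction requires an argument.\<close>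

lemma HA_axiom_EA:
  assumes "A \<in> HA_axioms" and "wf_fm arith A"
  shows "eprov arith EA_axioms {} (rs A)"
  using assms
proof (induction rule: HA_axioms.induct)
  case 1
  have "eprov arith EA_axioms {} (MUni (MNeg (MEq (succ_tm (Var 0)) zero_tm)))"
    by (rule eAx) (auto intro: EA_axioms.intros simp: arith_def)
  from eUniE [OF this, of "Var 0"]
  have "eprov arith EA_axioms {} (MNeg (MEq (succ_tm (Var 0)) zero_tm))"
    by (simp add: inst_def)
  with eprov_rs_Imp [where A = "Eq (succ_tm (Var 0)) zero_tm" and B = Fls]
  have "eprov arith EA_axioms {} (rs (Neg (Eq (succ_tm (Var 0)) zero_tm)))"
    by simp
  then show ?case by (simp only: rs.simps) (intro eUniI, simp)
next
  case 2
  have "eprov arith EA_axioms {}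
      (MUni (MUni (MImp (MEq (succ_tm (Var 1)) (succ_tm (Var 0))) (MEq (Var 1) (Var 0)))))"
    by (intro eAx EA_axioms.intros) (simp add: arith_def)
  \<comment> \<open>\<open>Var 1\<close> becomes \<open>Var 2\<close> under the inner quantifier;
    instantiating that one with \<open>Var 0\<close> lowers it to \<open>Var 1\<close>
    again.\<close>
  from eUniE [OF this, of "Var 1"]
  have "eprov arith EA_axioms {}
      (MUni (MImp (MEq (succ_tm (Var 2)) (succ_tm (Var 0))) (MEq (Var 2) (Var 0))))"
    by (simp add: inst_def up_def shift_def numeral_2_eq_2)
  from eUniE [OF this, of "Var 0"]
  have "eprov arith EA_axioms {}
      (MImp (MEq (succ_tm (Var 1)) (succ_tm (Var 0))) (MEq (Var 1) (Var 0)))"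
    by (simp add: inst_def numeral_2_eq_2)
  with eprov_rs_Imp [where A = "Eq (succ_tm (Var 1)) (succ_tm (Var 0))" and B = "Eq (Var 1) (Var 0)"]
  have "eprov arith EA_axioms {} (rs (Imp (Eq (succ_tm (Var 1)) (succ_tm (Var 0))) (Eq (Var 1) (Var 0))))"
    by simp
  then show ?case by (simp only: rs.simps) (intro eUniI, simp)
next
  case (7 A)
  let ?Z = "msubst (inst zero_tm) (rs A)" and ?S = "msubst step (rs A)"
  let ?H = "Box (MCon ?Z (MUni (Box (MImp (Box (rs A)) (Box ?S)))))"
  have wfZ: "wf_mfm arith ?Z"
    by (intro wf_msubst wf_rs 7 wf_inst) (simp add: arith_def)
  have wfstep: "wf_tm arith (step i)" for i
    by (cases i) (simp_all add: step_def arith_def)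
  have wfS: "wf_mfm arith ?S"
    by (intro wf_msubst wf_rs 7 wfstep)
  have wfA: "wf_mfm arith (rs A)"
    using 7 by (simp add: wf_rs)
  have H: "eprov arith EA_axioms {?H} (MCon ?Z (MUni (Box (MImp (Box (rs A)) (Box ?S)))))"
    by (rule eBoxE [OF eprov_hyp]) (simp add: wfZ wfS wfA)
  have Z: "eprov arith EA_axioms {?H} (Box ?Z)"
    by (rule eprov_BoxI_Box [OF eConE1 [OF H]])
  have "eprov arith EA_axioms {msubst shift ?H} (msubst shift ?H)"
    by (intro eprov_hyp wf_msubst wf_shift) (simp add: wfZ wfS wfA)
  then have "eprov arith EA_axioms {msubst shift ?H}
      (msubst shift (MUni (Box (MImp (Box (rs A)) (Box ?S)))))"
    by (simp only: msubst.simps) (rule eConE2 [OF eBoxE])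
  then have "eprov arith EA_axioms (msubst shift ` {?H}) (MImp (Box (rs A)) (Box ?S))"
    by (simp only: image_insert image_empty) (rule eBoxE [OF eprov_UniE_Var0])
  then have S: "eprov arith EA_axioms {?H} (MUni (MImp (Box (rs A)) (msubst step (Box (rs A)))))"
    by (simp only: msubst.simps) (rule eUniI)
  \<comment> \<open>Induction is applied to the modal formula \<open>Box (rs A)\<close>, because the
    translated induction step leads from a boxed formula to a boxed formula.\<close>
  have "eprov arith EA_axioms {?H} (MImp (MCon (msubst (inst zero_tm) (Box (rs A)))
      (MUni (MImp (Box (rs A)) (msubst step (Box (rs A)))))) (MUni (Box (rs A))))"
    by (intro eAx EA_axioms.intros) (simp_all add: wfZ wfS wfA)
  from eImpE [OF this eConI] Z S have "eprov arith EA_axioms {?H} (MUni (Box (rs A)))"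
    by simp
  then have "eprov arith EA_axioms {?H} (MUni (rs A))"
    by (rule eprov_MUni_BoxE)
  then have "eprov arith EA_axioms {} (Box (MImp ?H (Box (MUni (rs A)))))"
    by (intro eprov_BoxI_empty eprov_BoxI_Box eImpI) (simp_all add: wfZ wfS wfA)
  then show ?case
    by (simp add: rs_subst)
qed (simp only: rs.simps, intro eAx EA_axioms.intros, simp add: arith_def)+

section \<open>Vectors of quantifiers and finite conjunctions\<close>

text \<open>The \<open>n\<close>-fold iterates of \<open>shift\<close>, \<open>up\<close> and \<open>inst\<close>.\<close>

definition shifts :: "nat \<Rightarrow> nat \<Rightarrow> 'f tm" where
  "shifts n i = Var (n + i)"

definition ups :: "nat \<Rightarrow> (nat \<Rightarrow> 'f tm) \<Rightarrow> nat \<Rightarrow> 'f tm" where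
  "ups n \<sigma> i = (if i < n then Var i else subst_tm (shifts n) (\<sigma> (i - n)))"

definition insts :: "nat \<Rightarrow> (nat \<Rightarrow> 'f tm) \<Rightarrow> nat \<Rightarrow> 'f tm" where
  "insts n \<tau> i = (if i < n then \<tau> i else Var (i - n))"

primrec Conj :: "('f, 'p) fm list \<Rightarrow> ('f, 'p) fm" where
  "Conj [] = Neg Fls"
| "Conj (A # As) = Con A (Conj As)"

lemma wf_shifts: "wf_tm \<Sigma> (shifts n i)"
  by (simp add: shifts_def)

lemma shifts_0: "shifts 0 = Var"
  by (simp add: shifts_def fun_eq_iff)

lemma shifts_Suc: "subst_tm (shifts n) \<circ> shift = shifts (Suc n)"
  by (simp add: shifts_def shift_def fun_eq_iff)

lemma ups_0: "ups 0 \<sigma> = \<sigma>"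
  by (simp add: ups_def shifts_0 subst_tm_Var fun_eq_iff)

text \<open>Unfolds at the outermost quantifier, as the induction in \<open>subst_Unis\<close>
  demands.\<close>

lemma ups_Suc: "ups (Suc n) \<sigma> = ups n (up \<sigma>)"
proof
  show "ups (Suc n) \<sigma> i = ups n (up \<sigma>) i" for i
  proof (cases "i \<le> n")
    case True
    then show ?thesis by (auto simp: ups_def up_def shifts_def)
  next
    case False
    then obtain k where "i = n + Suc k"
      by (metis add_Suc_right less_imp_Suc_add not_le)
    then show ?thesis by (simp add: ups_def up_def subst_tm_comp shifts_Suc)
  qed
qed

lemma ups_shifts: "subst_tm (ups n \<sigma>) \<circ> shifts n = subst_tm (shifts n) \<circ> \<sigma>"
  by (simp add: ups_def shifts_def fun_eq_iff)

lemma insts_shifts: "subst_tm (insts n \<tau>) \<circ> shifts n = Var"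
  by (simp add: insts_def shifts_def fun_eq_iff)

lemma subst_Unis: "subst \<sigma> ((Uni ^^ n) A) = (Uni ^^ n) (subst (ups n \<sigma>) A)"
  by (induction n arbitrary: \<sigma>) (simp_all add: ups_0 ups_Suc)

lemma wf_Unis: "wf_fm \<Sigma> ((Uni ^^ n) A) \<longleftrightarrow> wf_fm \<Sigma> A"
  by (induction n) simp_all

lemma iprov_UnisI: "iprov \<Sigma> T (subst (shifts n) ` \<Gamma>) A \<Longrightarrow> iprov \<Sigma> T \<Gamma> ((Uni ^^ n) A)"
  by (induction n arbitrary: \<Gamma>)
    (auto simp: shifts_0 subst_Var image_image subst_comp shifts_Suc intro!: iUniI)

lemma iprov_UnisE:
  assumes "iprov \<Sigma> T \<Gamma> ((Uni ^^ n) A)" and "\<And>i. wf_tm \<Sigma> (\<tau> i)"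
  shows "iprov \<Sigma> T \<Gamma> (subst (insts n \<tau>) A)"
  using assms
proof (induction n arbitrary: A \<tau>)
  case 0
  have "insts 0 \<tau> = Var"
    by (simp add: insts_def fun_eq_iff)
  with 0 show ?case by (simp add: subst_Var)
next
  case (Suc n)
  \<comment> \<open>The outer \<open>n\<close> quantifiers are removed first and take the values of
    \<open>\<tau>\<close> from index 1 on; index 0 belongs to the innermost quantifier, which is
    left for last.\<close>
  let ?\<tau> = "\<lambda>i. \<tau> (Suc i)"
  have "iprov \<Sigma> T \<Gamma> (Uni (subst (up (insts n ?\<tau>)) A))"
    using Suc.IH [of "Uni A" ?\<tau>] Suc.prems by (simp add: funpow_swap1)
  then have "iprov \<Sigma> T \<Gamma> (subst (inst (\<tau> 0)) (subst (up (insts n ?\<tau>)) A))"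
    using Suc.prems(2) by (rule iUniE)
  moreover have "case_nat (\<tau> 0) (insts n ?\<tau>) = insts (Suc n) \<tau>"
    by (auto simp: insts_def fun_eq_iff split: nat.split)
  ultimately show ?case by (simp add: subst_comp inst_up)
qed

lemma subst_Conj: "subst \<sigma> (Conj As) = Conj (map (subst \<sigma>) As)"
  by (induction As) simp_all

lemma wf_Conj: "wf_fm \<Sigma> (Conj As) \<longleftrightarrow> (\<forall>A\<in>set As. wf_fm \<Sigma> A)"
  by (induction As) simp_all

lemma iprov_ConjI: "(\<And>A. A \<in> set As \<Longrightarrow> iprov \<Sigma> T \<Gamma> A) \<Longrightarrow> iprov \<Sigma> T \<Gamma> (Conj As)"
proof (induction As)
  case Nil
  show ?case by (simp, intro iImpI iprov_hyp) simp_all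
qed (simp add: iConI)

lemma iprov_ConjE: "iprov \<Sigma> T \<Gamma> (Conj As) \<Longrightarrow> A \<in> set As \<Longrightarrow> iprov \<Sigma> T \<Gamma> A"
  by (induction As) (auto dest: iConE1 iConE2)

section \<open>Double negation relative to a formula\<close>

text \<open>For fixed \<open>E\<close> this is the continuation monad with answer type
  \<open>E\<close>; the lemmas below give its unit, bind, multiplication and functorial action
  inside derivations.\<close>

abbreviation dneg :: "('f, 'p) fm \<Rightarrow> ('f, 'p) fm \<Rightarrow> ('f, 'p) fm" where
  "dneg E A \<equiv> Imp (Imp A E) E"

lemma iprov_dnegI:
  assumes "iprov \<Sigma> T \<Gamma> A" and "wf_fm \<Sigma> E"
  shows "iprov \<Sigma> T \<Gamma> (dneg E A)"
proof -
  have wf: "wf_fm \<Sigma> (Imp A E)"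
    using assms by (simp add: iprov_wf)
  then show ?thesis
    by (intro iImpI iImpE [OF iprov_hyp iprov_insert]) (use assms in auto)
qed

lemma iprov_dnegE:
  assumes "iprov \<Sigma> T \<Gamma> (dneg E A)" and "iprov \<Sigma> T (insert A \<Gamma>) E"
  shows "iprov \<Sigma> T \<Gamma> E"
proof -
  have "wf_fm \<Sigma> A"
    using iprov_wf [OF assms(1)] by simp
  then show ?thesis
    using assms by (meson iImpI iImpE)
qed

lemma iprov_dneg_bind:
  assumes "iprov \<Sigma> T \<Gamma> (dneg E A)" and "iprov \<Sigma> T (insert A \<Gamma>) (dneg E B)"
  shows "iprov \<Sigma> T \<Gamma> (dneg E B)"
proof -
  have wf: "wf_fm \<Sigma> (Imp B E)"
    using iprov_wf [OF assms(2)] by simp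
  have "iprov \<Sigma> T (insert (Imp B E) \<Gamma>) E"
  proof (rule iprov_dnegE)
    show "iprov \<Sigma> T (insert (Imp B E) \<Gamma>) (dneg E A)"
      using assms(1) by (rule iprov_insert)
    have "iprov \<Sigma> T (insert A (insert (Imp B E) \<Gamma>)) (dneg E B)"
      using assms(2) by (rule iprov_mono) auto
    moreover have "iprov \<Sigma> T (insert A (insert (Imp B E) \<Gamma>)) (Imp B E)"
      using wf by (intro iprov_insert iprov_hyp)
    ultimately show "iprov \<Sigma> T (insert A (insert (Imp B E) \<Gamma>)) E"
      by (rule iImpE)
  qed
  with wf show ?thesis by (rule iImpI)
qed

lemma iprov_dneg_flatten:
  assumes "iprov \<Sigma> T \<Gamma> (dneg E (dneg E A))"
  shows "iprov \<Sigma> T \<Gamma> (dneg E A)"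
  using assms
proof (rule iprov_dneg_bind)
  show "iprov \<Sigma> T (insert (dneg E A) \<Gamma>) (dneg E A)"
    using iprov_wf [OF assms] by (intro iprov_hyp) simp
qed

lemma iprov_dneg_map:
  assumes "iprov \<Sigma> T \<Gamma> (dneg E A)" and "iprov \<Sigma> T (insert A \<Gamma>) B"
  shows "iprov \<Sigma> T \<Gamma> (dneg E B)"
proof (rule iprov_dneg_bind [OF assms(1)])
  have "wf_fm \<Sigma> E"
    using iprov_wf [OF assms(1)] by simp
  with assms(2) show "iprov \<Sigma> T (insert A \<Gamma>) (dneg E B)"
    by (rule iprov_dnegI)
qed

lemma iprov_dneg_bind_finite:
  assumes "finite \<Delta>" and "\<And>A. A \<in> \<Delta> \<Longrightarrow> iprov \<Sigma> T \<Gamma> (dneg E A)"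
    and "iprov \<Sigma> T (\<Delta> \<union> \<Gamma>) (dneg E B)"
  shows "iprov \<Sigma> T \<Gamma> (dneg E B)"
  using assms
proof (induction \<Delta>)
  case (insert A \<Delta>)
  have "iprov \<Sigma> T (\<Delta> \<union> \<Gamma>) (dneg E A)"
    by (rule iprov_mono [OF insert.prems(1)]) simp_all
  with insert.prems(2) have "iprov \<Sigma> T (\<Delta> \<union> \<Gamma>) (dneg E B)"
    by simp (rule iprov_dneg_bind)
  with insert show ?case by simp
qed simp

section \<open>The interpretation of modal formulas\<close>

text \<open>
  The worlds are the substitution instances of the formulas in the list \<open>L\<close>, whose free variables
  are assumed to be below \<open>n\<close>; at the world \<open>E\<close>, classical logic is interpreted by double negation
  relative to \<open>E\<close>. A vector of \<open>n\<close> quantifiers expresses quantification over all worlds. The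
  renaming \<open>\<rho>\<close> acts on the free variables of the modal formula, to keep them apart from those of \<open>E\<close>.
\<close>

primrec tr :: "('f, 'p) fm list \<Rightarrow> nat \<Rightarrow> ('f, 'p) mfm \<Rightarrow> (nat \<Rightarrow> 'f tm) \<Rightarrow> ('f, 'p) fm \<Rightarrow> ('f, 'p) fm"
where
  "tr L n MFls \<rho> E = E"
| "tr L n (MEq s t) \<rho> E = dneg E (Eq (subst_tm \<rho> s) (subst_tm \<rho> t))"
| "tr L n (MPred p ts) \<rho> E = dneg E (Pred p (map (subst_tm \<rho>) ts))"
| "tr L n (MDis A B) \<rho> E = dneg E (Dis (tr L n A \<rho> E) (tr L n B \<rho> E))"
| "tr L n (MCon A B) \<rho> E = Con (tr L n A \<rho> E) (tr L n B \<rho> E)"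
| "tr L n (MImp A B) \<rho> E = Imp (tr L n A \<rho> E) (tr L n B \<rho> E)"
| "tr L n (MExi A) \<rho> E = dneg E (Exi (tr L n A (up \<rho>) (subst shift E)))"
| "tr L n (MUni A) \<rho> E = Uni (tr L n A (up \<rho>) (subst shift E))"
| "tr L n (Box A) \<rho> E = dneg E ((Uni ^^ n) (Conj (map (tr L n A (subst_tm (shifts n) \<circ> \<rho>)) L)))"

text \<open>No current world occurs in this formula, so a boxed assumption can be carried from one
  world to any other. \<open>shifts n\<close> keeps the values of \<open>\<rho>\<close> clear of the
  quantifiers that range over worlds.\<close>

definition everywhere ::
  "('f, 'p) fm list \<Rightarrow> nat \<Rightarrow> ('f, 'p) mfm \<Rightarrow> (nat \<Rightarrow> 'f tm) \<Rightarrow> ('f, 'p) fm" where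
  "everywhere L n A \<rho> = (Uni ^^ n) (Conj (map (tr L n A (subst_tm (shifts n) \<circ> \<rho>)) L))"

lemma tr_Box: "tr L n (Box A) \<rho> E = dneg E (everywhere L n A \<rho>)"
  by (simp add: everywhere_def)

text \<open>Free variables are bounded through substitutions because this is how the bound is used:
  \<open>ups n \<sigma>\<close> is compared with \<open>Var\<close>, and
  \<open>insts n \<tau>\<close> with \<open>\<tau>\<close>.\<close>

definition fv_below :: "nat \<Rightarrow> ('f, 'p) fm \<Rightarrow> bool" where
  "fv_below n A \<longleftrightarrow> (\<forall>\<sigma> \<tau>. (\<forall>i<n. \<sigma> i = \<tau> i) \<longrightarrow> subst \<sigma> A = subst \<tau> A)"

locale worlds =
  fixes \<Sigma> :: "('f, 'p) signature" and T :: "('f, 'p) fm set"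
    and L :: "('f, 'p) fm list" and n :: nat
  assumes wf_L: "F \<in> set L \<Longrightarrow> wf_fm \<Sigma> F"
    and fv_L: "F \<in> set L \<Longrightarrow> fv_below n F"
begin

abbreviation wf_sub :: "(nat \<Rightarrow> 'f tm) \<Rightarrow> bool" where
  "wf_sub \<rho> \<equiv> \<forall>i. wf_tm \<Sigma> (\<rho> i)"

definition world :: "('f, 'p) fm \<Rightarrow> bool" where
  "world E \<longleftrightarrow> (\<exists>F\<in>set L. \<exists>\<tau>. wf_sub \<tau> \<and> E = subst \<tau> F)"

abbreviation interp :: "('f, 'p) mfm \<Rightarrow> (nat \<Rightarrow> 'f tm) \<Rightarrow> ('f, 'p) fm \<Rightarrow> ('f, 'p) fm" where
  "interp \<equiv> tr L n"

abbreviation ev :: "('f, 'p) mfm \<Rightarrow> (nat \<Rightarrow> 'f tm) \<Rightarrow> ('f, 'p) fm" where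
  "ev \<equiv> everywhere L n"

abbreviation prov :: "('f, 'p) fm set \<Rightarrow> ('f, 'p) fm \<Rightarrow> bool" where
  "prov \<equiv> iprov \<Sigma> T"

lemma world_L: "F \<in> set L \<Longrightarrow> world F"
  unfolding world_def by (intro bexI [of _ F] exI [of _ Var]) (simp_all add: subst_Var)

text \<open>Passing under a quantifier shifts the current world, so the worlds have to be closed
  under substitution; the list \<open>L\<close> alone would not be.\<close>

lemma world_subst:
  assumes "world E" and "wf_sub \<sigma>"
  shows "world (subst \<sigma> E)"
proof -
  obtain F \<tau> where "F \<in> set L" "wf_sub \<tau>" "E = subst \<tau> F"
    using assms(1) by (auto simp: world_def)
  then show ?thesis
    unfolding world_def using assms(2)
    by (intro bexI [of _ F] exI [of _ "subst_tm \<sigma> \<circ> \<tau>"]) (simp_all add: subst_comp wf_subst_tm)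
qed

lemma world_shift: "world E \<Longrightarrow> world (subst shift E)"
  by (simp add: world_subst wf_shift)

lemma world_wf: "world E \<Longrightarrow> wf_fm \<Sigma> E"
  unfolding world_def by (auto intro: wf_subst wf_L)

section \<open>Well-formedness of the interpretation and its behaviour under substitution\<close>

lemma wf_interp: "wf_mfm \<Sigma> A \<Longrightarrow> wf_sub \<rho> \<Longrightarrow> wf_fm \<Sigma> E \<Longrightarrow> wf_fm \<Sigma> (interp A \<rho> E)"
  by (induction A arbitrary: \<rho> E)
    (simp_all add: wf_subst_tm wf_subst wf_up wf_shift wf_Unis wf_Conj wf_L wf_shifts)

lemma wf_ev: "wf_mfm \<Sigma> A \<Longrightarrow> wf_sub \<rho> \<Longrightarrow> wf_fm \<Sigma> (ev A \<rho>)"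
  by (simp add: everywhere_def wf_Unis wf_Conj wf_L wf_interp wf_subst_tm wf_shifts)

text \<open>The \<open>n\<close> quantifiers bind all free variables of \<open>F\<close>, so a
  substitution lifted over them cannot reach it.\<close>

lemma subst_ups_L:
  assumes "F \<in> set L"
  shows "subst (ups n \<sigma>) F = F"
proof -
  have "subst (ups n \<sigma>) F = subst Var F"
    using fv_L [OF assms] unfolding fv_below_def by (simp add: ups_def)
  then show ?thesis by (simp only: subst_Var)
qed

lemma subst_interp:
  "subst \<sigma> (interp A \<rho> E) = interp A (subst_tm \<sigma> \<circ> \<rho>) (subst \<sigma> E)"
proof (induction A arbitrary: \<sigma> \<rho> E)
  case (Box A)
  have "subst_tm (ups n \<sigma>) \<circ> (subst_tm (shifts n) \<circ> \<rho>) = subst_tm (shifts n) \<circ> (subst_tm \<sigma> \<circ> \<rho>)"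
    by (simp add: fun_eq_iff subst_tm_comp ups_shifts)
  then have "map (subst (ups n \<sigma>) \<circ> interp A (subst_tm (shifts n) \<circ> \<rho>)) L
      = map (interp A (subst_tm (shifts n) \<circ> (subst_tm \<sigma> \<circ> \<rho>))) L"
    by (intro map_cong refl) (simp only: o_apply [of "subst _"] Box.IH subst_ups_L)
  then show ?case by (simp only: tr.simps subst.simps subst_Unis subst_Conj map_map)
qed (auto simp: subst_tm_comp subst_comp subst_tm_shift_up up_comp)

lemma subst_ev: "subst \<sigma> (ev A \<rho>) = ev A (subst_tm \<sigma> \<circ> \<rho>)"
  using subst_interp [of \<sigma> "Box A" \<rho> Fls] by (simp add: everywhere_def)

text \<open>A substitution in the modal formula is absorbed by \<open>\<rho>\<close> and leaves the
  world alone; this is the purpose of the extra argument.\<close>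

lemma interp_msubst: "interp (msubst \<sigma> A) \<rho> E = interp A (subst_tm \<rho> \<circ> \<sigma>) E"
proof (induction A arbitrary: \<sigma> \<rho> E)
  case (Box A)
  show ?case
    by (simp only: tr.simps msubst.simps Box.IH subst_tm_o_assoc cong: map_cong)
qed (simp_all add: subst_tm_comp up_comp)

lemma interp_inst: "interp (msubst (inst t) A) \<rho> E
    = subst (inst (subst_tm \<rho> t)) (interp A (up \<rho>) (subst shift E))"
  by (simp add: interp_msubst subst_interp comp_inst inst_up subst_comp inst_shift subst_Var)

lemma interp_shift: "interp (msubst shift A) (up \<rho>) (subst shift E) = subst shift (interp A \<rho> E)"
  by (simp add: interp_msubst subst_interp subst_tm_shift_up)

text \<open>A world is an instance of some \<open>F\<close> in \<open>L\<close>: the conjunct for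
  \<open>F\<close> is selected and the quantifiers are instantiated by the substitution that
  produces the world.\<close>

lemma evE:
  assumes "prov \<Gamma> (ev A \<rho>)" and "world E"
  shows "prov \<Gamma> (interp A \<rho> E)"
proof -
  obtain F \<tau> where F: "F \<in> set L" and \<tau>: "wf_sub \<tau>" and E: "E = subst \<tau> F"
    using assms(2) by (auto simp: world_def)
  have "prov \<Gamma> (subst (insts n \<tau>) (Conj (map (interp A (subst_tm (shifts n) \<circ> \<rho>)) L)))"
    using assms(1) \<tau> unfolding everywhere_def by (simp add: iprov_UnisE)
  then have "prov \<Gamma> (subst (insts n \<tau>) (interp A (subst_tm (shifts n) \<circ> \<rho>) F))"
    unfolding subst_Conj using F by (auto intro: iprov_ConjE)
  \<comment> \<open>\<open>insts n \<tau>\<close> agrees with \<open>\<tau>\<close> only below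
    \<open>n\<close>, which is enough because \<open>F\<close> has no free variables beyond.\<close>
  moreover have "subst (insts n \<tau>) F = E"
    using fv_L [OF F] unfolding fv_below_def E by (simp add: insts_def)
  moreover have "subst_tm (insts n \<tau>) \<circ> (subst_tm (shifts n) \<circ> \<rho>) = \<rho>"
    by (simp add: fun_eq_iff subst_tm_comp insts_shifts subst_tm_Var)
  ultimately show ?thesis by (simp add: subst_interp)
qed

text \<open>Only the members of \<open>L\<close> have to be checked, and these are worlds
  themselves; as the context is shifted by \<open>n\<close>, their free variables act as
  eigenvariables.\<close>

lemma evI:
  assumes "\<And>F. world F \<Longrightarrow> prov (subst (shifts n) ` \<Gamma>) (interp A (subst_tm (shifts n) \<circ> \<rho>) F)"
  shows "prov \<Gamma> (ev A \<rho>)"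
  unfolding everywhere_def using assms by (intro iprov_UnisI iprov_ConjI) (auto dest: world_L intro: assms)

text \<open>Atoms, disjunctions, existential formulas and boxes are double negations already, and
  \<open>MFls\<close> becomes \<open>E\<close>; the remaining connectives inherit stability from
  their parts. This validates classical reasoning at each world.\<close>

lemma interp_stable:
  assumes "wf_mfm \<Sigma> A" and "wf_sub \<rho>" and "wf_fm \<Sigma> E"
    and "prov \<Gamma> (dneg E (interp A \<rho> E))"
  shows "prov \<Gamma> (interp A \<rho> E)"
  using assms
proof (induction A arbitrary: \<rho> E \<Gamma>)
  case MFls
  then show ?case by (simp only: tr.simps) (erule iprov_dnegE, rule iprov_hyp)
next
  case (MCon A B)
  have "prov (insert (interp (MCon A B) \<rho> E) \<Gamma>) (Con (interp A \<rho> E) (interp B \<rho> E))"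
    using wf_interp [OF MCon.prems(1-3)] by (simp add: iprov_hyp)
  then have "prov \<Gamma> (dneg E (interp A \<rho> E))" "prov \<Gamma> (dneg E (interp B \<rho> E))"
    by (rule iprov_dneg_map [OF MCon.prems(4) iConE1], simp)
      (rule iprov_dneg_map [OF MCon.prems(4) iConE2], simp)
  with MCon show ?case by (simp add: iConI)
next
  case (MImp A B)
  let ?A = "interp A \<rho> E"
  have wf: "wf_fm \<Sigma> (interp (MImp A B) \<rho> E)" "wf_fm \<Sigma> ?A"
    using wf_interp MImp.prems by auto
  have "prov (insert ?A \<Gamma>) (dneg E (interp B \<rho> E))"
  proof (rule iprov_dneg_map)
    show "prov (insert ?A \<Gamma>) (dneg E (interp (MImp A B) \<rho> E))"
      using MImp.prems(4) by (rule iprov_insert)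
    show "prov (insert (interp (MImp A B) \<rho> E) (insert ?A \<Gamma>)) (interp B \<rho> E)"
      by (rule iImpE [where A = ?A]; rule iAssm) (use wf in simp_all)
  qed
  with MImp wf show ?case by (simp add: iImpI)
next
  case (MUni A)
  let ?E = "subst shift E" and ?U = "interp (MUni A) \<rho> E"
  let ?A = "interp A (up \<rho>) ?E"
  have wf: "wf_fm \<Sigma> ?U" "wf_fm \<Sigma> (subst shift ?U)" "wf_fm \<Sigma> ?E" "wf_mfm \<Sigma> A" "wf_sub (up \<rho>)"
    using wf_interp [OF MUni.prems(1-3)] MUni.prems by (auto intro: wf_subst wf_shift wf_up)
  \<comment> \<open>The argument runs over the doubly negated formula alone, which can be shifted
    for \<open>iUniI\<close>; a final cut returns to \<open>\<Gamma>\<close>.\<close>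
  have "prov {subst shift (dneg E ?U)} (dneg ?E ?A)"
  proof (rule iprov_dneg_map)
    show "prov {subst shift (dneg E ?U)} (dneg ?E (subst shift ?U))"
      using wf by (simp only: subst.simps) (intro iprov_hyp, simp)
    show "prov (insert (subst shift ?U) {subst shift (dneg E ?U)}) ?A"
      using iprov_hyp [OF wf(2)] by (simp only: tr.simps) (rule iprov_UniE_Var0)
  qed
  with MUni.IH wf have "prov (subst shift ` {dneg E ?U}) ?A"
    by simp
  then have "prov {dneg E ?U} ?U"
    by (simp only: tr.simps) (rule iUniI)
  then have "prov (insert (dneg E ?U) \<Gamma>) ?U"
    by (rule iprov_mono) simp
  with MUni.prems(4) show ?case by (rule iprov_cut)
qed (simp only: tr.simps, erule iprov_dneg_flatten)+

text \<open>Lets the elimination rules use a disjunction, existential formula, equation or box that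
  is available only up to double negation.\<close>

lemma interp_bind:
  assumes "prov \<Gamma> (dneg E X)" and "prov (insert X \<Gamma>) (interp A \<rho> E)"
    and "wf_mfm \<Sigma> A" and "wf_sub \<rho>" and "world E"
  shows "prov \<Gamma> (interp A \<rho> E)"
  using assms by (auto intro: interp_stable iprov_dneg_map world_wf)

text \<open>Up to double negation, the boxed assumptions at \<open>E\<close> yield the formulas in
  \<open>?D\<close>, which hold independently of \<open>E\<close> and give the same assumptions back
  at every world \<open>F\<close>. There the derivation is evaluated. The double negations at
  \<open>E\<close> are harmless because the conclusion is one as well.\<close>

lemma interp_BoxI:
  assumes "finite \<Delta>" and "\<Delta> \<subseteq> \<Gamma>" and "\<Delta> \<subseteq> range Box" and "\<And>B. B \<in> \<Delta> \<Longrightarrow> wf_mfm \<Sigma> B"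
    and prov: "\<And>F \<sigma>. world F \<Longrightarrow> wf_sub \<sigma> \<Longrightarrow> prov ((\<lambda>B. interp B \<sigma> F) ` \<Delta>) (interp A \<sigma> F)"
    and \<rho>: "wf_sub \<rho>" and E: "world E"
  shows "prov ((\<lambda>B. interp B \<rho> E) ` \<Gamma>) (interp (Box A) \<rho> E)"
proof -
  let ?D = "(\<lambda>B. ev B \<rho>) ` (Box -` \<Delta>)" and ?\<rho> = "subst_tm (shifts n) \<circ> \<rho>"
  have fin: "finite ?D"
    using assms(1) by (intro finite_imageI finite_vimageI) (simp_all add: inj_def)
  have wf: "wf_mfm \<Sigma> B" if "Box B \<in> \<Delta>" for B
    using assms(4) [OF that] by simp
  have \<rho>': "wf_sub ?\<rho>"
    using \<rho> by (simp add: wf_subst_tm wf_shifts)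
  have "prov ?D (ev A \<rho>)"
  proof (rule evI)
    fix F assume F: "world F"
    show "prov (subst (shifts n) ` ?D) (interp A ?\<rho> F)"
    proof (rule iprov_cut_finite)
      show "finite ((\<lambda>B. interp B ?\<rho> F) ` \<Delta>)"
        using assms(1) by simp
      show "prov ((\<lambda>B. interp B ?\<rho> F) ` \<Delta>) (interp A ?\<rho> F)"
        using F \<rho>' by (rule prov)
      fix X assume "X \<in> (\<lambda>B. interp B ?\<rho> F) ` \<Delta>"
      then obtain B where B: "Box B \<in> \<Delta>" and X: "X = dneg F (ev B ?\<rho>)"
        using assms(3) by (auto simp: everywhere_def)
      have "prov (subst (shifts n) ` ?D) (ev B ?\<rho>)"
        using B wf [OF B] \<rho>' by (intro iAssm wf_ev) (force simp: subst_ev)+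
      then show "prov (subst (shifts n) ` ?D) X"
        unfolding X using F by (intro iprov_dnegI world_wf)
    qed
  qed
  then have "prov (?D \<union> (\<lambda>B. interp B \<rho> E) ` \<Gamma>) (ev A \<rho>)"
    by (rule iprov_mono) simp
  then have main: "prov (?D \<union> (\<lambda>B. interp B \<rho> E) ` \<Gamma>) (dneg E (ev A \<rho>))"
    using E by (intro iprov_dnegI world_wf)
  have hyps: "prov ((\<lambda>B. interp B \<rho> E) ` \<Gamma>) (dneg E X)" if D: "X \<in> ?D" for X
  proof -
    obtain B where B: "Box B \<in> \<Delta>" and X: "X = ev B \<rho>"
      using D by blast
    have "interp (Box B) \<rho> E \<in> (\<lambda>B. interp B \<rho> E) ` \<Gamma>"
      using B assms(2) by blast
    then have "prov ((\<lambda>B. interp B \<rho> E) ` \<Gamma>) (interp (Box B) \<rho> E)"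
      using wf [OF B] \<rho> E by (intro iAssm wf_interp world_wf) simp_all
    then show ?thesis by (simp only: tr_Box X)
  qed
  show ?thesis
    unfolding tr_Box using fin hyps main by (rule iprov_dneg_bind_finite)
qed

text \<open>\<open>\<rho>\<close> and \<open>E\<close> vary in the induction: quantifier rules pass
  to \<open>up \<rho>\<close> and the shifted world, and \<open>eBoxI\<close> visits all worlds.
  Finiteness and well-formedness of the context pass from the conclusion of each rule to its
  premises and serve \<open>interp_BoxI\<close>.\<close>

lemma interp_sound:
  assumes ax: "\<And>A \<rho> E. A \<in> T' \<Longrightarrow> wf_mfm \<Sigma> A \<Longrightarrow> wf_sub \<rho> \<Longrightarrow> world E \<Longrightarrow> prov {} (interp A \<rho> E)"
    and "eprov \<Sigma> T' \<Gamma> A" and "finite \<Gamma>" and "\<forall>B\<in>\<Gamma>. wf_mfm \<Sigma> B"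
    and "wf_sub \<rho>" and "world E"
  shows "prov ((\<lambda>B. interp B \<rho> E) ` \<Gamma>) (interp A \<rho> E)"
  using assms(2-)
proof (induction arbitrary: \<rho> E rule: eprov.induct)
  case (eAx A \<Gamma>)
  have "prov {} (interp A \<rho> E)"
    using eAx by (intro ax) auto
  then show ?case by (rule iprov_mono) simp
next
  case (eAssm A \<Gamma>)
  then show ?case by (intro iAssm wf_interp world_wf) auto
next
  case (eClass A \<Gamma>)
  \<comment> \<open>The interpretation of \<open>MNeg A\<close> is an implication into
    \<open>E\<close>, so discharging it gives a double negation, which stability removes.\<close>
  have "prov (insert (Imp (interp A \<rho> E) E) ((\<lambda>B. interp B \<rho> E) ` \<Gamma>)) E"
    using eClass.IH [of \<rho> E] eClass.prems eClass.hyps(1) by auto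
  then have "prov ((\<lambda>B. interp B \<rho> E) ` \<Gamma>) (dneg E (interp A \<rho> E))"
    using eClass by (intro iImpI) (auto intro: wf_interp world_wf)
  then show ?case
    using eClass by (intro interp_stable) (auto intro: world_wf)
next
  case (eConI \<Gamma> A B)
  then show ?case by (simp add: iConI)
next
  case (eConE1 \<Gamma> A B)
  then show ?case by (metis tr.simps(5) iConE1)
next
  case (eConE2 \<Gamma> A B)
  then show ?case by (metis tr.simps(5) iConE2)
next
  case (eDisI1 \<Gamma> A B)
  then have "prov ((\<lambda>B. interp B \<rho> E) ` \<Gamma>) (Dis (interp A \<rho> E) (interp B \<rho> E))"
    by (intro iDisI1) (auto intro: wf_interp world_wf)
  then show ?case
    using eDisI1.prems(4) by (simp add: iprov_dnegI world_wf)
next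
  case (eDisI2 \<Gamma> B A)
  then have "prov ((\<lambda>B. interp B \<rho> E) ` \<Gamma>) (Dis (interp A \<rho> E) (interp B \<rho> E))"
    by (intro iDisI2) (auto intro: wf_interp world_wf)
  then show ?case
    using eDisI2.prems(4) by (simp add: iprov_dnegI world_wf)
next
  case (eDisE \<Gamma> A B C)
  let ?\<Gamma> = "(\<lambda>B. interp B \<rho> E) ` \<Gamma>" and ?A = "interp A \<rho> E" and ?B = "interp B \<rho> E"
  have wf: "wf_mfm \<Sigma> A" "wf_mfm \<Sigma> B" "wf_mfm \<Sigma> C"
    using eprov_wf [OF eDisE.hyps(1)] eprov_wf [OF eDisE.hyps(2)] by simp_all
  have A: "prov (insert ?A ?\<Gamma>) (interp C \<rho> E)" and B: "prov (insert ?B ?\<Gamma>) (interp C \<rho> E)"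
    using eDisE.IH(2) [of \<rho> E] eDisE.IH(3) [of \<rho> E] eDisE.prems wf by auto
  show ?case
  proof (rule interp_bind)
    show "prov ?\<Gamma> (dneg E (Dis ?A ?B))"
      using eDisE.IH(1) [of \<rho> E] eDisE.prems by simp
    show "prov (insert (Dis ?A ?B) ?\<Gamma>) (interp C \<rho> E)"
    proof (rule iDisE)
      show "prov (insert (Dis ?A ?B) ?\<Gamma>) (Dis ?A ?B)"
        using eDisE.prems wf by (intro iprov_hyp) (simp add: wf_interp world_wf)
    qed (use A B in \<open>auto elim: iprov_mono\<close>)
  qed (use eDisE.prems wf in simp_all)
next
  case (eImpI A \<Gamma> B)
  then show ?case by (simp add: iImpI wf_interp world_wf)
next
  case (eImpE \<Gamma> A B)
  then show ?case by (metis tr.simps(6) iImpE)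
next
  case (eUniI \<Gamma> A)
  have "prov ((\<lambda>B. interp B (up \<rho>) (subst shift E)) ` msubst shift ` \<Gamma>)
      (interp A (up \<rho>) (subst shift E))"
    using eUniI.prems by (intro eUniI.IH) (auto intro: wf_msubst wf_shift wf_up world_shift)
  then show ?case by (auto intro!: iUniI simp: image_image interp_shift)
next
  case (eUniE \<Gamma> A t)
  then have "prov ((\<lambda>B. interp B \<rho> E) ` \<Gamma>) (Uni (interp A (up \<rho>) (subst shift E)))"
    by simp
  then show ?case
    unfolding interp_inst using eUniE by (intro iUniE wf_subst_tm) auto
next
  case (eExiI A t \<Gamma>)
  have "prov ((\<lambda>B. interp B \<rho> E) ` \<Gamma>) (interp (msubst (inst t) A) \<rho> E)"
    using eExiI by blast
  then have "prov ((\<lambda>B. interp B \<rho> E) ` \<Gamma>) (Exi (interp A (up \<rho>) (subst shift E)))"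
    unfolding interp_inst using eExiI
    by (intro iExiI [where t = "subst_tm \<rho> t"]) (simp_all add: wf_interp wf_subst_tm wf_up world_wf world_shift)
  then show ?case
    using eExiI.prems(4) by (simp add: iprov_dnegI world_wf)
next
  case (eExiE \<Gamma> A C)
  let ?\<Gamma> = "(\<lambda>B. interp B \<rho> E) ` \<Gamma>" and ?A = "interp A (up \<rho>) (subst shift E)"
  have wf: "wf_mfm \<Sigma> A" "wf_mfm \<Sigma> C"
    using eprov_wf [OF eExiE.hyps(1)] eprov_wf [OF eExiE.hyps(2)] by (auto dest: wf_msubstD)
  have "prov ((\<lambda>B. interp B (up \<rho>) (subst shift E)) ` insert A (msubst shift ` \<Gamma>))
      (interp (msubst shift C) (up \<rho>) (subst shift E))"
    using eExiE.prems wf by (intro eExiE.IH) (auto intro: wf_msubst wf_shift wf_up world_shift)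
  then have C: "prov (insert ?A (subst shift ` ?\<Gamma>)) (subst shift (interp C \<rho> E))"
    by (simp add: image_image interp_shift)
  show ?case
  proof (rule interp_bind)
    show "prov ?\<Gamma> (dneg E (Exi ?A))"
      using eExiE.IH(1) [of \<rho> E] eExiE.prems by simp
    show "prov (insert (Exi ?A) ?\<Gamma>) (interp C \<rho> E)"
    proof (rule iExiE)
      show "prov (insert (Exi ?A) ?\<Gamma>) (Exi ?A)"
        using eExiE.prems wf by (intro iprov_hyp) (simp add: wf_interp wf_up world_wf world_shift)
      show "prov (insert ?A (subst shift ` insert (Exi ?A) ?\<Gamma>)) (subst shift (interp C \<rho> E))"
        using C by (rule iprov_mono) auto
    qed
  qed (use eExiE.prems wf in simp_all)
next
  case (eEqI t \<Gamma>)
  then show ?case by (auto intro!: iprov_dnegI iEqI wf_subst_tm world_wf)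
next
  case (eEqE A \<Gamma> s t)
  let ?\<Gamma> = "(\<lambda>B. interp B \<rho> E) ` \<Gamma>" and ?A = "interp A (up \<rho>) (subst shift E)"
  let ?s = "subst_tm \<rho> s" and ?t = "subst_tm \<rho> t"
  have wf: "wf_tm \<Sigma> s" "wf_tm \<Sigma> t"
    using eprov_wf [OF eEqE.hyps(2)] by simp_all
  show ?case
  proof (rule interp_bind)
    show "prov ?\<Gamma> (dneg E (Eq ?s ?t))"
      using eEqE.IH(1) [of \<rho> E] eEqE.prems by simp
    have "prov ?\<Gamma> (subst (inst ?s) ?A)"
      using eEqE.IH(2) [of \<rho> E] eEqE.prems by (simp add: interp_inst)
    then show "prov (insert (Eq ?s ?t) ?\<Gamma>) (interp (msubst (inst t) A) \<rho> E)"
      unfolding interp_inst using eEqE.prems eEqE.hyps(1) wf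
      by (intro iEqE [OF _ iprov_hyp iprov_insert])
        (simp_all add: wf_interp wf_subst_tm wf_up world_wf world_shift)
  qed (use eEqE.prems eEqE.hyps(1) wf in \<open>simp_all add: wf_msubst wf_inst\<close>)
next
  case (eBoxI \<Delta> \<Gamma> A)
  have "finite \<Delta>"
    using eBoxI.hyps(1) eBoxI.prems(1) by (rule finite_subset)
  moreover have "\<forall>B\<in>\<Delta>. wf_mfm \<Sigma> B"
    using eBoxI.hyps(1) eBoxI.prems(2) by blast
  ultimately show ?case
    using eBoxI by (intro interp_BoxI [where \<Delta> = \<Delta>]) simp_all
next
  case (eBoxE \<Gamma> A)
  have wf: "wf_mfm \<Sigma> A"
    using eprov_wf [OF eBoxE.hyps] by simp
  show ?case
  proof (rule interp_bind)
    show "prov ((\<lambda>B. interp B \<rho> E) ` \<Gamma>) (dneg E (ev A \<rho>))"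
      using eBoxE.IH [OF eBoxE.prems] by (simp only: tr_Box)
    show "prov (insert (ev A \<rho>) ((\<lambda>B. interp B \<rho> E) ` \<Gamma>)) (interp A \<rho> E)"
      using eBoxE.prems wf by (intro evE iprov_hyp wf_ev)
  qed (use eBoxE.prems wf in simp_all)
qed

section \<open>Faithfulness of the interpretation on translated formulas\<close>

lemma iprov_dneg_self:
  assumes "prov \<Gamma> (dneg E E)"
  shows "prov \<Gamma> E"
  using assms by (rule iprov_dnegE) (use iprov_wf [OF assms] in \<open>simp add: iprov_hyp\<close>)

text \<open>\<open>evI\<close> shifts the context, over which the derivation of \<open>X\<close> is
  not given. Working from \<open>X\<close> alone makes the shift visible, and a cut restores
  \<open>\<Gamma>\<close>.\<close>

lemma evI_single:
  assumes "prov \<Gamma> X"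
    and "\<And>F. world F \<Longrightarrow> prov {subst (shifts n) X} (interp A (subst_tm (shifts n) \<circ> \<rho>) F)"
  shows "prov \<Gamma> (ev A \<rho>)"
proof (rule iprov_cut [OF assms(1)])
  have "prov {X} (ev A \<rho>)"
    using assms(2) by (intro evI) simp
  then show "prov (insert X \<Gamma>) (ev A \<rho>)"
    by (rule iprov_mono) simp
qed

text \<open>The second half speaks of a single world because the clauses of \<open>rs\<close> for
  conjunction and universal quantification carry no box: there the parts are compared at the same
  world. \<open>faithfulD3\<close> recovers truth at all worlds.\<close>

definition faithful :: "('f, 'p) fm \<Rightarrow> bool" where
  "faithful C \<longleftrightarrow> (\<forall>\<Gamma> \<rho>. wf_sub \<rho> \<longrightarrow>
    (prov \<Gamma> (ev (rs C) \<rho>) \<longrightarrow> prov \<Gamma> (subst \<rho> C)) \<and>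
    (\<forall>E. world E \<longrightarrow> prov \<Gamma> (subst \<rho> C) \<longrightarrow> prov \<Gamma> (interp (rs C) \<rho> E)))"

lemma faithfulD1: "faithful C \<Longrightarrow> wf_sub \<rho> \<Longrightarrow> prov \<Gamma> (ev (rs C) \<rho>) \<Longrightarrow> prov \<Gamma> (subst \<rho> C)"
  by (simp add: faithful_def)

lemma faithfulD2:
  "faithful C \<Longrightarrow> wf_sub \<rho> \<Longrightarrow> world E \<Longrightarrow> prov \<Gamma> (subst \<rho> C) \<Longrightarrow> prov \<Gamma> (interp (rs C) \<rho> E)"
  by (simp add: faithful_def)

lemma faithfulD3:
  assumes "faithful C" and "wf_sub \<rho>" and "prov \<Gamma> (subst \<rho> C)"
  shows "prov \<Gamma> (ev (rs C) \<rho>)"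
  using assms(3)
proof (rule evI_single)
  fix F assume "world F"
  moreover have "prov {subst (shifts n) (subst \<rho> C)} (subst (shifts n) (subst \<rho> C))"
    using iprov_wf [OF assms(3)] by (intro iprov_hyp) (simp add: wf_subst wf_shifts)
  ultimately show "prov {subst (shifts n) (subst \<rho> C)} (interp (rs C) (subst_tm (shifts n) \<circ> \<rho>) F)"
    using assms(1,2) by (intro faithfulD2) (simp_all add: subst_comp wf_subst_tm wf_shifts)
qed

lemma iprov_dneg_evD:
  assumes "faithful C" and "wf_sub \<rho>" and "prov \<Gamma> (dneg E (ev (rs C) \<rho>))"
  shows "prov \<Gamma> (dneg E (subst \<rho> C))"
  using assms(3)
proof (rule iprov_dneg_map)
  show "prov (insert (ev (rs C) \<rho>) \<Gamma>) (subst \<rho> C)"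
    using assms(1,2) iprov_wf [OF assms(3)] by (intro faithfulD1 [OF _ _ iprov_hyp]) simp_all
qed

lemma iprov_dneg_evI:
  assumes "faithful C" and "wf_sub \<rho>" and "prov \<Gamma> (dneg E (subst \<rho> C))"
  shows "prov \<Gamma> (dneg E (ev (rs C) \<rho>))"
  using assms(3)
proof (rule iprov_dneg_map)
  show "prov (insert (subst \<rho> C) \<Gamma>) (ev (rs C) \<rho>)"
    using assms(1,2) iprov_wf [OF assms(3)] by (intro faithfulD3 [OF _ _ iprov_hyp]) simp_all
qed

lemma faithfulI:
  assumes "\<And>\<Gamma> \<rho>. wf_sub \<rho> \<Longrightarrow> prov \<Gamma> (ev (rs C) \<rho>) \<Longrightarrow> prov \<Gamma> (subst \<rho> C)"
    and "\<And>\<Gamma> \<rho> E. wf_sub \<rho> \<Longrightarrow> world E \<Longrightarrow> prov \<Gamma> (subst \<rho> C) \<Longrightarrow> prov \<Gamma> (interp (rs C) \<rho> E)"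
  shows "faithful C"
  using assms by (simp add: faithful_def)

section \<open>Faithfulness for each connective\<close>

lemma world_subst_L: "F \<in> set L \<Longrightarrow> wf_sub \<rho> \<Longrightarrow> world (subst \<rho> F)"
  by (simp add: world_L world_subst)

lemma wf_shifts_comp: "wf_sub \<rho> \<Longrightarrow> wf_sub (subst_tm (shifts n) \<circ> \<rho>)"
  by (simp add: wf_subst_tm wf_shifts)

lemma faithful_Fls: "Fls \<in> set L \<Longrightarrow> faithful Fls"
proof (rule faithfulI)
  fix \<Gamma> \<rho> assume "Fls \<in> set L" "prov \<Gamma> (ev (rs Fls) \<rho>)"
  \<comment> \<open>At the world \<open>Fls\<close> the interpretation of \<open>MFls\<close> is
    absurdity itself; this is why \<open>Fls\<close> belongs to \<open>L\<close>.\<close>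
  then have "prov \<Gamma> (interp (rs Fls) \<rho> Fls)"
    by (intro evE world_L)
  then show "prov \<Gamma> (subst \<rho> Fls)"
    by simp
next
  fix \<Gamma> \<rho> E assume "world E" "prov \<Gamma> (subst \<rho> Fls)"
  then show "prov \<Gamma> (interp (rs Fls) \<rho> E)"
    unfolding subst.simps rs.simps tr.simps by (metis iFlsE world_wf)
qed

lemma faithful_Eq:
  assumes "Eq s t \<in> set L"
  shows "faithful (Eq s t)"
proof (rule faithfulI)
  fix \<Gamma> \<rho> assume "wf_sub \<rho>" "prov \<Gamma> (ev (rs (Eq s t)) \<rho>)"
  then have "prov \<Gamma> (interp (rs (Eq s t)) \<rho> (subst \<rho> (Eq s t)))"
    using assms by (intro evE world_subst_L)
  then show "prov \<Gamma> (subst \<rho> (Eq s t))"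
    unfolding rs.simps tr.simps subst.simps by (rule iprov_dneg_self)
qed (simp add: iprov_dnegI world_wf)

lemma faithful_Pred:
  assumes "Pred p ts \<in> set L"
  shows "faithful (Pred p ts)"
proof (rule faithfulI)
  fix \<Gamma> \<rho>
  let ?P = "subst \<rho> (Pred p ts)"
  assume \<rho>: "wf_sub \<rho>" and "prov \<Gamma> (ev (rs (Pred p ts)) \<rho>)"
  \<comment> \<open>With the atom itself as the world, the double negation of the box and that of
    the atom both collapse.\<close>
  then have "prov \<Gamma> (interp (rs (Pred p ts)) \<rho> ?P)"
    using assms by (intro evE world_subst_L)
  then have *: "prov \<Gamma> (dneg ?P (ev (MPred p ts) \<rho>))"
    by (simp only: rs.simps tr_Box)
  then show "prov \<Gamma> ?P"
  proof (rule iprov_dnegE)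
    have "prov (insert (ev (MPred p ts) \<rho>) \<Gamma>) (interp (MPred p ts) \<rho> ?P)"
      using \<rho> assms iprov_wf [OF *] by (intro evE world_subst_L iprov_hyp) simp_all
    then show "prov (insert (ev (MPred p ts) \<rho>) \<Gamma>) ?P"
      unfolding tr.simps subst.simps by (rule iprov_dneg_self)
  qed
next
  fix \<Gamma> \<rho> E
  let ?P = "subst \<rho> (Pred p ts)"
  assume E: "world E" and P: "prov \<Gamma> ?P"
  from P have "prov \<Gamma> (ev (MPred p ts) \<rho>)"
  proof (rule evI_single)
    fix F assume "world F"
    moreover have "prov {subst (shifts n) ?P} (subst (shifts n) ?P)"
      using iprov_wf [OF P] by (intro iprov_hyp) (simp add: wf_subst_tm wf_shifts)
    ultimately show "prov {subst (shifts n) ?P} (interp (MPred p ts) (subst_tm (shifts n) \<circ> \<rho>) F)"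
      by (simp add: iprov_dnegI world_wf subst_tm_comp o_def)
  qed
  then show "prov \<Gamma> (interp (rs (Pred p ts)) \<rho> E)"
    using E by (simp only: rs.simps tr_Box iprov_dnegI world_wf)
qed

lemma faithful_Dis:
  assumes "Dis A B \<in> set L" and A: "faithful A" and B: "faithful B"
  shows "faithful (Dis A B)"
proof (rule faithfulI)
  fix \<Gamma> \<rho>
  let ?D = "subst \<rho> (Dis A B)"
  let ?A = "dneg ?D (ev (rs A) \<rho>)" and ?B = "dneg ?D (ev (rs B) \<rho>)"
  assume \<rho>: "wf_sub \<rho>" and "prov \<Gamma> (ev (rs (Dis A B)) \<rho>)"
  then have "prov \<Gamma> (interp (rs (Dis A B)) \<rho> ?D)"
    using assms by (intro evE world_subst_L)
  then have *: "prov \<Gamma> (dneg ?D (Dis ?A ?B))"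
    by (simp only: rs.simps tr.simps(4) tr_Box)
  then show "prov \<Gamma> ?D"
  proof (rule iprov_dnegE)
    have wf: "wf_fm \<Sigma> ?A" "wf_fm \<Sigma> ?B" "wf_fm \<Sigma> (subst \<rho> A)" "wf_fm \<Sigma> (subst \<rho> B)"
      using iprov_wf [OF *] by simp_all
    show "prov (insert (Dis ?A ?B) \<Gamma>) ?D"
    proof (rule iDisE)
      show "prov (insert (Dis ?A ?B) \<Gamma>) (Dis ?A ?B)"
        using wf by (intro iprov_hyp) simp
      \<comment> \<open>The disjunct is recovered only up to double negation relative to
        \<open>?D\<close>, which suffices because \<open>?D\<close> is the goal.\<close>
      have "prov (insert ?A (insert (Dis ?A ?B) \<Gamma>)) (dneg ?D (subst \<rho> A))"
        using A \<rho> wf by (intro iprov_dneg_evD iprov_hyp)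
      then show "prov (insert ?A (insert (Dis ?A ?B) \<Gamma>)) ?D"
        by (rule iprov_dnegE) (use wf in \<open>simp add: iDisI1 iprov_hyp\<close>)
      have "prov (insert ?B (insert (Dis ?A ?B) \<Gamma>)) (dneg ?D (subst \<rho> B))"
        using B \<rho> wf by (intro iprov_dneg_evD iprov_hyp)
      then show "prov (insert ?B (insert (Dis ?A ?B) \<Gamma>)) ?D"
        by (rule iprov_dnegE) (use wf in \<open>simp add: iDisI2 iprov_hyp\<close>)
    qed
  qed
next
  fix \<Gamma> \<rho> E
  let ?A = "dneg E (ev (rs A) \<rho>)" and ?B = "dneg E (ev (rs B) \<rho>)"
  assume \<rho>: "wf_sub \<rho>" and E: "world E" and D: "prov \<Gamma> (subst \<rho> (Dis A B))"
  have wf: "wf_fm \<Sigma> (subst \<rho> A)" "wf_fm \<Sigma> (subst \<rho> B)" "wf_fm \<Sigma> E"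
    using iprov_wf [OF D] E by (simp_all add: world_wf)
  have 1: "prov (insert (subst \<rho> A) \<Gamma>) ?A"
    using A \<rho> wf by (intro iprov_dnegI faithfulD3 iprov_hyp)
  have 2: "prov (insert (subst \<rho> B) \<Gamma>) ?B"
    using B \<rho> wf by (intro iprov_dnegI faithfulD3 iprov_hyp)
  from D have "prov \<Gamma> (Dis ?A ?B)"
    unfolding subst.simps
    by (rule iDisE) (use 1 2 in \<open>auto intro: iDisI1 iDisI2 iprov_wf\<close>)
  then show "prov \<Gamma> (interp (rs (Dis A B)) \<rho> E)"
    unfolding rs.simps tr.simps(4) tr_Box using wf by (intro iprov_dnegI)
qed

text \<open>No special world is chosen: the conjunction splits at every world, so both parts hold at
  all worlds.\<close>

lemma faithful_Con:
  assumes A: "faithful A" and B: "faithful B"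
  shows "faithful (Con A B)"
proof (rule faithfulI)
  fix \<Gamma> \<rho>
  let ?C = "ev (rs (Con A B)) \<rho>" and ?\<rho> = "subst_tm (shifts n) \<circ> \<rho>"
  assume \<rho>: "wf_sub \<rho>" and C: "prov \<Gamma> ?C"
  have *: "prov {subst (shifts n) ?C} (Con (interp (rs A) ?\<rho> F) (interp (rs B) ?\<rho> F))"
    if F: "world F" for F
  proof -
    have "prov {subst (shifts n) ?C} (ev (rs (Con A B)) ?\<rho>)"
      using iprov_wf [OF C] by (simp add: subst_ev [symmetric]) (intro iprov_hyp wf_subst wf_shifts)
    from evE [OF this F] show ?thesis by simp
  qed
  have "prov \<Gamma> (ev (rs A) \<rho>)" "prov \<Gamma> (ev (rs B) \<rho>)"
    by (rule evI_single [OF C], rule iConE1, erule *, rule evI_single [OF C], rule iConE2, erule *)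
  with A B \<rho> show "prov \<Gamma> (subst \<rho> (Con A B))"
    unfolding subst.simps by (intro iConI faithfulD1)
next
  fix \<Gamma> \<rho> E
  assume \<rho>: "wf_sub \<rho>" and E: "world E" and "prov \<Gamma> (subst \<rho> (Con A B))"
  then have "prov \<Gamma> (Con (subst \<rho> A) (subst \<rho> B))"
    by simp
  note D = iConE1 [OF this] iConE2 [OF this]
  show "prov \<Gamma> (interp (rs (Con A B)) \<rho> E)"
    using faithfulD2 [OF A \<rho> E D(1)] faithfulD2 [OF B \<rho> E D(2)] by (simp only: rs.simps tr.simps iConI)
qed

text \<open>The world to evaluate at is the instance of the consequent \<open>B\<close>, not of the
  implication: then all boxes are double negations relative to the goal that remains once
  \<open>A\<close> is assumed.\<close>

lemma faithful_Imp:
  assumes "B \<in> set L" and A: "faithful A" and B: "faithful B"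
    and wfA: "wf_fm \<Sigma> A"
  shows "faithful (Imp A B)"
proof (rule faithfulI)
  fix \<Gamma> \<rho>
  let ?I = "MImp (Box (rs A)) (Box (rs B))"
  let ?A = "subst \<rho> A" and ?B = "subst \<rho> B"
  assume \<rho>: "wf_sub \<rho>" and I: "prov \<Gamma> (ev (rs (Imp A B)) \<rho>)"
  have wf: "wf_fm \<Sigma> ?A" "wf_fm \<Sigma> ?B"
    using \<rho> wfA wf_L [OF assms(1)] by (simp_all add: wf_subst)
  have world: "world ?B"
    using assms(1) \<rho> by (rule world_subst_L)
  have "prov \<Gamma> (interp (rs (Imp A B)) \<rho> ?B)"
    using I world by (rule evE)
  then have *: "prov \<Gamma> (dneg ?B (ev ?I \<rho>))"
    by (simp only: rs.simps tr_Box)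
  then have "prov (insert ?A \<Gamma>) (dneg ?B (ev ?I \<rho>))"
    by (rule iprov_insert)
  then have "prov (insert ?A \<Gamma>) ?B"
  proof (rule iprov_dnegE)
    let ?\<Gamma> = "insert (ev ?I \<rho>) (insert ?A \<Gamma>)"
    have "prov ?\<Gamma> (interp ?I \<rho> ?B)"
      using iprov_wf [OF *] world by (intro evE iprov_hyp) simp_all
    then have "prov ?\<Gamma> (Imp (dneg ?B (ev (rs A) \<rho>)) (dneg ?B (ev (rs B) \<rho>)))"
      by (simp only: tr.simps(6) tr_Box)
    moreover have "prov ?\<Gamma> (dneg ?B (ev (rs A) \<rho>))"
      using A \<rho> wf by (intro iprov_dnegI faithfulD3 iprov_insert [OF iprov_hyp])
    ultimately have "prov ?\<Gamma> (dneg ?B (ev (rs B) \<rho>))"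
      by (rule iImpE)
    with B \<rho> have "prov ?\<Gamma> (dneg ?B ?B)"
      by (rule iprov_dneg_evD)
    then show "prov ?\<Gamma> ?B"
      by (rule iprov_dneg_self)
  qed
  with wf show "prov \<Gamma> (subst \<rho> (Imp A B))"
    by (simp add: iImpI)
next
  fix \<Gamma> \<rho> E
  let ?I = "MImp (Box (rs A)) (Box (rs B))"
  let ?X = "subst \<rho> (Imp A B)" and ?\<rho> = "subst_tm (shifts n) \<circ> \<rho>"
  assume \<rho>: "wf_sub \<rho>" and E: "world E" and X: "prov \<Gamma> ?X"
  from X have "prov \<Gamma> (ev ?I \<rho>)"
  proof (rule evI_single)
    fix F assume F: "world F"
    let ?A = "dneg F (ev (rs A) ?\<rho>)"
    have wfX: "wf_fm \<Sigma> (subst ?\<rho> (Imp A B))"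
      using wfA wf_L [OF assms(1)] wf_shifts_comp [OF \<rho>] by (intro wf_subst) auto
    have wf: "wf_fm \<Sigma> ?A"
      using wfA F wf_shifts_comp [OF \<rho>] by (simp add: wf_ev wf_rs world_wf)
    have "prov {?A, subst ?\<rho> (Imp A B)} (dneg F (subst ?\<rho> A))"
      using A wf_shifts_comp [OF \<rho>] iprov_hyp [OF wf] by (rule iprov_dneg_evD)
    then have "prov {?A, subst ?\<rho> (Imp A B)} (dneg F (subst ?\<rho> B))"
    proof (rule iprov_dneg_map)
      show "prov {subst ?\<rho> A, ?A, subst ?\<rho> (Imp A B)} (subst ?\<rho> B)"
        by (rule iImpE [where A = "subst ?\<rho> A"]; rule iAssm) (use wfX in simp_all)
    qed
    with B wf_shifts_comp [OF \<rho>] have "prov {?A, subst ?\<rho> (Imp A B)} (dneg F (ev (rs B) ?\<rho>))"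
      by (rule iprov_dneg_evI)
    with wf have "prov {subst ?\<rho> (Imp A B)} (Imp ?A (dneg F (ev (rs B) ?\<rho>)))"
      by (rule iImpI)
    then show "prov {subst (shifts n) ?X} (interp ?I ?\<rho> F)"
      by (simp only: subst_comp tr.simps(6) tr_Box)
  qed
  then show "prov \<Gamma> (interp (rs (Imp A B)) \<rho> E)"
    using E by (simp only: rs.simps tr_Box iprov_dnegI world_wf)
qed

text \<open>The world is the existential formula itself. A witness is found only up to double
  negation relative to it, which is enough to conclude it.\<close>

lemma faithful_Exi:
  assumes "Exi A \<in> set L" and A: "faithful A"
  shows "faithful (Exi A)"
proof (rule faithfulI)
  fix \<Gamma> \<rho>
  let ?X = "subst \<rho> (Exi A)"
  let ?A = "dneg (subst shift ?X) (ev (rs A) (up \<rho>))"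
  assume \<rho>: "wf_sub \<rho>" and "prov \<Gamma> (ev (rs (Exi A)) \<rho>)"
  then have "prov \<Gamma> (interp (rs (Exi A)) \<rho> ?X)"
    using assms by (intro evE world_subst_L)
  then have *: "prov \<Gamma> (dneg ?X (Exi ?A))"
    by (simp only: rs.simps tr.simps(7) tr_Box)
  then show "prov \<Gamma> ?X"
  proof (rule iprov_dnegE)
    have wf: "wf_fm \<Sigma> ?A" "wf_fm \<Sigma> (subst (up \<rho>) A)"
      using iprov_wf [OF *] by simp_all
    show "prov (insert (Exi ?A) \<Gamma>) ?X"
    proof (rule iExiE)
      show "prov (insert (Exi ?A) \<Gamma>) (Exi ?A)"
        using wf by (intro iprov_hyp) simp
      let ?\<Gamma> = "insert ?A (subst shift ` insert (Exi ?A) \<Gamma>)"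
      have "prov ?\<Gamma> (dneg (subst shift ?X) (subst (up \<rho>) A))"
        using A \<rho> wf by (intro iprov_dneg_evD iprov_hyp) (simp_all add: wf_up)
      then show "prov ?\<Gamma> (subst shift ?X)"
      proof (rule iprov_dnegE)
        show "prov (insert (subst (up \<rho>) A) ?\<Gamma>) (subst shift ?X)"
          using iprov_ExiI_Var0 [OF iprov_hyp [OF wf(2)]] by simp
      qed
    qed
  qed
next
  fix \<Gamma> \<rho> E
  let ?X = "subst \<rho> (Exi A)"
  let ?A = "dneg (subst shift E) (ev (rs A) (up \<rho>))"
  assume \<rho>: "wf_sub \<rho>" and E: "world E" and X: "prov \<Gamma> ?X"
  have wf: "wf_fm \<Sigma> (subst (up \<rho>) A)" "wf_fm \<Sigma> (subst shift E)"
    using iprov_wf [OF X] E by (simp_all add: world_wf world_shift)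
  from X have "prov \<Gamma> (Exi ?A)"
    unfolding subst.simps
  proof (rule iExiE)
    have "prov (insert (subst (up \<rho>) A) (subst shift ` \<Gamma>)) ?A"
      using A \<rho> wf by (intro iprov_dnegI faithfulD3 iprov_hyp) (simp_all add: wf_up)
    then show "prov (insert (subst (up \<rho>) A) (subst shift ` \<Gamma>)) (subst shift (Exi ?A))"
      by (rule iprov_ExiI_Var0)
  qed
  then show "prov \<Gamma> (interp (rs (Exi A)) \<rho> E)"
    unfolding rs.simps tr.simps(7) tr_Box using E by (intro iprov_dnegI world_wf)
qed

lemma shifts_up:
  "subst_tm (shifts n) \<circ> up \<rho> = case_nat (shifts n 0) (subst_tm (shifts n) \<circ> (subst_tm shift \<circ> \<rho>))"
  by (auto simp: fun_eq_iff up_def split: nat.split)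

text \<open>Truth of the universal formula at all worlds gives truth of its body at all worlds for a
  fresh variable: universal quantifiers are merely exchanged. In the other direction the world stays
  fixed.\<close>

lemma faithful_Uni:
  assumes A: "faithful A"
  shows "faithful (Uni A)"
proof (rule faithfulI)
  fix \<Gamma> \<rho>
  let ?X = "ev (rs (Uni A)) \<rho>" and ?\<rho> = "subst_tm (shifts n) \<circ> (subst_tm shift \<circ> \<rho>)"
  assume \<rho>: "wf_sub \<rho>" and X: "prov \<Gamma> ?X"
  have wf: "wf_fm \<Sigma> ?X"
    using X by (rule iprov_wf)
  have "prov {subst shift ?X} (subst shift ?X)"
    using wf by (intro iprov_hyp wf_subst wf_shift)
  then have "prov {subst shift ?X} (ev (rs A) (up \<rho>))"
  proof (rule evI_single)
    fix F assume F: "world F"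
    have "prov {subst (shifts n) (subst shift ?X)} (subst (shifts n) (subst shift ?X))"
      using wf by (intro iprov_hyp wf_subst wf_shift wf_shifts)
    then have "prov {subst (shifts n) (subst shift ?X)} (ev (MUni (rs A)) ?\<rho>)"
      by (simp only: subst_ev rs.simps)
    from evE [OF this F]
    have "prov {subst (shifts n) (subst shift ?X)} (Uni (interp (rs A) (up ?\<rho>) (subst shift F)))"
      by simp
    \<comment> \<open>The instantiating term \<open>shifts n 0\<close> is the eigenvariable of the
      outer quantifier, moved to index \<open>n\<close> by the quantifiers over worlds.\<close>
    from iUniE [OF this wf_shifts [of _ _ 0]]
    show "prov {subst (shifts n) (subst shift ?X)} (interp (rs A) (subst_tm (shifts n) \<circ> up \<rho>) F)"
      by (simp only: subst_interp inst_up subst_comp inst_shift subst_Var shifts_up)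
  qed
  with A \<rho> have "prov (subst shift ` {?X}) (subst (up \<rho>) A)"
    by (simp add: faithfulD1 wf_up)
  then have "prov {?X} (subst \<rho> (Uni A))"
    by (simp only: subst.simps) (rule iUniI)
  then have "prov (insert ?X \<Gamma>) (subst \<rho> (Uni A))"
    by (rule iprov_mono) simp
  with X show "prov \<Gamma> (subst \<rho> (Uni A))"
    by (rule iprov_cut)
next
  fix \<Gamma> \<rho> E
  let ?X = "subst \<rho> (Uni A)"
  assume \<rho>: "wf_sub \<rho>" and E: "world E" and X: "prov \<Gamma> ?X"
  have "prov {subst shift ?X} (subst shift (Uni (subst (up \<rho>) A)))"
    using iprov_wf [OF X] by (simp, intro iprov_hyp) (simp add: wf_subst wf_up wf_shift)
  then have "prov (subst shift ` {?X}) (subst (up \<rho>) A)"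
    using iprov_UniE_Var0 by simp
  then have "prov (subst shift ` {?X}) (interp (rs A) (up \<rho>) (subst shift E))"
    using A \<rho> E by (intro faithfulD2) (simp_all add: wf_up world_shift)
  then have "prov {?X} (interp (rs (Uni A)) \<rho> E)"
    by (simp only: rs.simps tr.simps) (rule iUniI)
  then have "prov (insert ?X \<Gamma>) (interp (rs (Uni A)) \<rho> E)"
    by (rule iprov_mono) simp
  with X show "prov \<Gamma> (interp (rs (Uni A)) \<rho> E)"
    by (rule iprov_cut)
qed

text \<open>The body of a quantifier is listed with its bound variable as a free index 0; the
  substitution instances that count as worlds supply all its values.\<close>

primrec (in -) subfms :: "('f, 'p) fm \<Rightarrow> ('f, 'p) fm list" where
  "subfms Fls = [Fls]"
| "subfms (Eq s t) = [Eq s t]"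
| "subfms (Pred p ts) = [Pred p ts]"
| "subfms (Dis A B) = Dis A B # subfms A @ subfms B"
| "subfms (Con A B) = Con A B # subfms A @ subfms B"
| "subfms (Imp A B) = Imp A B # subfms A @ subfms B"
| "subfms (Exi A) = Exi A # subfms A"
| "subfms (Uni A) = Uni A # subfms A"

lemma (in -) subfms_self: "A \<in> set (subfms A)"
  by (cases A) simp_all

lemma (in -) wf_subfms: "wf_fm \<Sigma> A \<Longrightarrow> B \<in> set (subfms A) \<Longrightarrow> wf_fm \<Sigma> B"
  by (induction A) auto

lemma faithful_subfms: "Fls \<in> set L \<Longrightarrow> set (subfms A) \<subseteq> set L \<Longrightarrow> faithful A"
proof (induction A)
  case (Imp A B)
  have "A \<in> set L" "B \<in> set L"
    using Imp.prems(2) subfms_self by auto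
  with Imp show ?case by (auto intro!: faithful_Imp wf_L)
qed (auto intro: faithful_Fls faithful_Eq faithful_Pred faithful_Dis faithful_Con faithful_Exi faithful_Uni)

end

section \<open>Existence of bounds on free variables\<close>

lemma bounded_list:
  fixes P :: "nat \<Rightarrow> 'a \<Rightarrow> bool"
  assumes "\<And>x. x \<in> set xs \<Longrightarrow> \<exists>n. P n x" and "\<And>m n x. P m x \<Longrightarrow> m \<le> n \<Longrightarrow> P n x"
  shows "\<exists>n. \<forall>x\<in>set xs. P n x"
  using assms(1)
proof (induction xs)
  case (Cons x xs)
  then have "\<exists>n. \<forall>x\<in>set xs. P n x" by simp
  then obtain n where "\<forall>x\<in>set xs. P n x" ..
  moreover obtain m where "P m x"
    using Cons.prems [of x] by auto
  ultimately have "\<forall>y\<in>set (x # xs). P (max m n) y"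
    using assms(2) by (auto intro: max.cobounded1 max.cobounded2)
  then show ?case ..
qed simp

definition tv_below :: "nat \<Rightarrow> 'f tm \<Rightarrow> bool" where
  "tv_below n t \<longleftrightarrow> (\<forall>\<sigma> \<tau> :: nat \<Rightarrow> 'f tm. (\<forall>i<n. \<sigma> i = \<tau> i) \<longrightarrow> subst_tm \<sigma> t = subst_tm \<tau> t)"

lemma tv_below_mono: "tv_below m t \<Longrightarrow> m \<le> n \<Longrightarrow> tv_below n t"
  by (simp add: tv_below_def)

lemma tv_below_exists_list:
  "(\<And>t. t \<in> set ts \<Longrightarrow> \<exists>n. tv_below n t) \<Longrightarrow> \<exists>n. \<forall>t\<in>set ts. tv_below n t"
  by (rule bounded_list [OF _ tv_below_mono])

lemma tv_below_exists: "\<exists>n. tv_below n t"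
proof (induction t)
  case (Var i)
  show ?case by (intro exI [of _ "Suc i"]) (simp add: tv_below_def)
next
  case (App f ts)
  then obtain n where "\<forall>t\<in>set ts. tv_below n t"
    using tv_below_exists_list by blast
  then have "tv_below n (App f ts)"
    by (simp add: tv_below_def)
  then show ?case ..
qed

lemma fv_below_mono: "fv_below m A \<Longrightarrow> m \<le> n \<Longrightarrow> fv_below n A"
  by (simp add: fv_below_def)

lemma fv_below_binary:
  assumes "\<exists>n. fv_below n A" and "\<exists>n. fv_below n B"
  obtains n where "fv_below n A" "fv_below n B"
proof -
  obtain k m where "fv_below k A" "fv_below m B"
    using assms by blast
  then have "fv_below (max k m) A" "fv_below (max k m) B"
    by (auto elim: fv_below_mono)
  then show thesis by (rule that)
qed

lemma up_cong: "\<forall>i<n. \<sigma> i = \<tau> i \<Longrightarrow> \<forall>i<n. up \<sigma> i = up \<tau> i"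
  by (auto simp: up_def split: nat.split)

text \<open>Only some bound is sought, so \<open>n\<close> is kept although the quantifier binds one
  index.\<close>

lemma fv_below_quantifier:
  assumes "fv_below n A"
  shows "fv_below n (Exi A)" "fv_below n (Uni A)"
  using assms by (simp_all add: fv_below_def up_cong)

lemma fv_below_exists: "\<exists>n. fv_below n A"
proof (induction A)
  case (Eq s t)
  obtain n where "\<forall>t\<in>set [s, t]. tv_below n t"
    using tv_below_exists_list tv_below_exists by blast
  then have "fv_below n (Eq s t)"
    by (simp add: fv_below_def tv_below_def)
  then show ?case ..
next
  case (Pred p ts)
  obtain n where "\<forall>t\<in>set ts. tv_below n t"
    using tv_below_exists_list tv_below_exists by blast
  then have "fv_below n (Pred p ts)"
    by (simp add: fv_below_def tv_below_def)
  then show ?case ..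
next
  case (Dis A B)
  then obtain n where "fv_below n A" "fv_below n B" by (rule fv_below_binary)
  then have "fv_below n (Dis A B)" by (simp add: fv_below_def)
  then show ?case ..
next
  case (Con A B)
  then obtain n where "fv_below n A" "fv_below n B" by (rule fv_below_binary)
  then have "fv_below n (Con A B)" by (simp add: fv_below_def)
  then show ?case ..
next
  case (Imp A B)
  then obtain n where "fv_below n A" "fv_below n B" by (rule fv_below_binary)
  then have "fv_below n (Imp A B)" by (simp add: fv_below_def)
  then show ?case ..
next
  case (Exi A)
  then show ?case by (blast intro: fv_below_quantifier)
next
  case (Uni A)
  then show ?case by (blast intro: fv_below_quantifier)
qed (simp add: fv_below_def)

lemma fv_below_exists_list: "\<exists>n. \<forall>F\<in>set Fs. fv_below n F"
  by (rule bounded_list [OF fv_below_exists fv_below_mono])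

text \<open>Soundness makes \<open>rs A\<close> true at every world, and faithfulness under the
  identity renaming returns \<open>A\<close>. The premise on axioms covers all \<open>L\<close> and
  \<open>n\<close> because these are chosen from \<open>A\<close> inside the proof.\<close>

lemma rs_faithful:
  fixes T :: "('f, 'p) fm set"
  assumes ax: "\<And>L n A \<rho> E. worlds \<Sigma> L n \<Longrightarrow> A \<in> T' \<Longrightarrow> wf_mfm \<Sigma> A \<Longrightarrow> \<forall>i. wf_tm \<Sigma> (\<rho> i) \<Longrightarrow>
      worlds.world \<Sigma> L E \<Longrightarrow> iprov \<Sigma> T {} (tr L n A \<rho> E)"
    and "wf_fm \<Sigma> A" and "eprov \<Sigma> T' {} (rs A)"
  shows "iprov \<Sigma> T {} A"
proof -
  let ?L = "Fls # subfms A"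
  obtain n where n: "\<forall>F\<in>set ?L. fv_below n F"
    using fv_below_exists_list [of ?L] ..
  have worlds: "worlds \<Sigma> ?L n"
  proof
    show "wf_fm \<Sigma> F" if "F \<in> set ?L" for F
      using that wf_subfms [OF assms(2)] by auto
    show "fv_below n F" if "F \<in> set ?L" for F
      using n that ..
  qed
  interpret worlds \<Sigma> T ?L n
    by (rule worlds)
  have "prov {} (interp (rs A) \<rho> E)" if "wf_sub \<rho>" "world E" for \<rho> E
  proof -
    have "prov ((\<lambda>B. interp B \<rho> E) ` {}) (interp (rs A) \<rho> E)"
      by (rule interp_sound [OF _ assms(3)], rule ax [OF worlds]) (use that in simp_all)
    then show ?thesis by simp
  qed
  then have "prov {} (ev (rs A) Var)"
    by (intro evI) (simp only: image_empty wf_shifts_comp wf_tm_Var simp_thms)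
  moreover have "faithful A"
    by (rule faithful_subfms) auto
  ultimately have "prov {} (subst Var A)"
    by (intro faithfulD1) simp_all
  then show ?thesis
    by (simp only: subst_Var)
qed

section \<open>Arithmetic\<close>

lemma up_Var0: "up \<sigma> 0 = Var 0"
  by (simp add: up_def)

lemma up_up_Var1: "up (up \<sigma>) (Suc 0) = Var (Suc 0)"
  by (simp add: up_def shift_def)

lemma funs_arith: "funs arith f = Some (case f of Zero \<Rightarrow> 0 | Succ \<Rightarrow> 1 | Plus \<Rightarrow> 2 | Times \<Rightarrow> 2)"
  by (simp add: arith_def)

lemma iprov_UniD:
  assumes "iprov \<Sigma> T {} (Uni A)" and "subst (inst (Var 0)) A = A"
  shows "iprov \<Sigma> T \<Gamma> A"
proof -
  have "iprov \<Sigma> T {} A"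
    using iUniE [OF assms(1), of "Var 0"] assms(2) by simp
  then show ?thesis by (rule iprov_mono) simp
qed

text \<open>The second premise says that reopening both quantifiers with their own variables changes
  nothing; for the closed axioms it is checked by evaluation.\<close>

lemma iprov_Uni_UniD:
  assumes "iprov \<Sigma> T {} (Uni (Uni A))"
    and "subst (inst (Var 0)) (subst (up (inst (Var 1))) A) = A"
  shows "iprov \<Sigma> T \<Gamma> A"
proof -
  have "iprov \<Sigma> T {} (subst (inst (Var 1)) (Uni A))"
    using iUniE [OF assms(1), of "Var 1"] by simp
  then have "iprov \<Sigma> T {} (subst (inst (Var 0)) (subst (up (inst (Var 1))) A))"
    by (simp add: iUniE)
  with assms(2) have "iprov \<Sigma> T {} A" by simp
  then show ?thesis by (rule iprov_mono) simp
qed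

text \<open>Equations become double negations of themselves, derivable from the arithmetic axioms at
  any world. Conjunction, implication and universal quantification are interpreted by themselves, so
  each instance of modal induction becomes an ordinary one.\<close>

lemma EA_axiom_HA:
  assumes "worlds arith L n" and "A \<in> EA_axioms" and "wf_mfm arith A"
    and "\<forall>i. wf_tm arith (\<rho> i)" and "worlds.world arith L E"
  shows "iprov arith HA_axioms {} (tr L n A \<rho> E)"
proof -
  interpret worlds arith HA_axioms L n
    by (rule assms(1))
  have wf: "wf_fm arith (subst shift E)" "wf_fm arith (subst shift (subst shift E))"
    using assms(5) by (simp_all add: world_wf world_shift)
  note eval_simps = up_Var0 up_up_Var1 inst_def up_def shift_def funs_arith
  show ?thesis
    using assms(2-3)
  proof (induction rule: EA_axioms.induct)
    case 1
    let ?X = "Eq (succ_tm (Var 0)) zero_tm"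
    have X: "prov \<Gamma> (Neg ?X)" for \<Gamma>
      by (rule iprov_UniD, rule iAx, rule HA_axioms.intros) (simp_all add: eval_simps)
    \<comment> \<open>Absurdity is interpreted by the world, so the task is to pass from the double
      negation of \<open>?X\<close> to the world; \<open>?X\<close> is refutable and gives it by ex
      falso.\<close>
    have "prov {dneg (subst shift E) ?X} (subst shift E)"
    proof (rule iprov_dnegE)
      show "prov {dneg (subst shift E) ?X} (dneg (subst shift E) ?X)"
        using wf by (intro iprov_hyp) (simp add: funs_arith)
      show "prov {?X, dneg (subst shift E) ?X} (subst shift E)"
        using wf by (intro iFlsE [OF iImpE [OF X iprov_hyp]]) (simp_all add: funs_arith)
    qed
    then have "prov {} (Uni (Imp (dneg (subst shift E) ?X) (subst shift E)))"
      by (intro iUniI iImpI) (simp_all add: wf funs_arith)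
    then show ?case
      by (simp add: up_Var0)
  next
    case 2
    let ?E = "subst shift (subst shift E)"
    let ?X = "Eq (succ_tm (Var 1)) (succ_tm (Var 0)) :: (arith_fun, unit) fm"
      and ?Y = "Eq (Var 1) (Var 0)"
    have X: "prov \<Gamma> (Imp ?X ?Y)" for \<Gamma>
      by (rule iprov_Uni_UniD, rule iAx, rule HA_axioms.intros) (simp_all add: eval_simps)
    have "prov (insert (dneg ?E ?X) (subst shift ` subst shift ` {})) (dneg ?E ?Y)"
      unfolding image_empty
    proof (rule iprov_dneg_map)
      show "prov {dneg ?E ?X} (dneg ?E ?X)"
        using wf by (intro iprov_hyp) (simp add: funs_arith)
      show "prov {?X, dneg ?E ?X} ?Y"
        by (rule iImpE [OF X iprov_hyp]) (simp add: funs_arith)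
    qed
    moreover have "wf_fm arith (dneg ?E ?X)"
      using wf by (simp add: funs_arith)
    ultimately have "prov {} (Uni (Uni (Imp (dneg ?E ?X) (dneg ?E ?Y))))"
      by (intro iUniI iImpI [where A = "dneg ?E ?X"])
    then show ?case
      by (simp add: up_Var0 up_up_Var1)
  next
    case 3
    have X: "prov \<Gamma> (Eq (plus_tm (Var 0) zero_tm) (Var 0))" for \<Gamma>
      by (rule iprov_UniD, rule iAx, rule HA_axioms.intros) (simp_all add: eval_simps)
    show ?case
      by (simp add: up_Var0) (intro iUniI iprov_dnegI X wf)
  next
    case 4
    have X: "prov \<Gamma> (Eq (plus_tm (Var 1) (succ_tm (Var 0))) (succ_tm (plus_tm (Var 1) (Var 0))))" for \<Gamma>
      by (rule iprov_Uni_UniD, rule iAx, rule HA_axioms.intros) (simp_all add: eval_simps)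
    show ?case
      by (simp add: up_Var0 up_up_Var1) (intro iUniI iprov_dnegI X [simplified] wf)
  next
    case 5
    have X: "prov \<Gamma> (Eq (times_tm (Var 0) zero_tm) zero_tm)" for \<Gamma>
      by (rule iprov_UniD, rule iAx, rule HA_axioms.intros) (simp_all add: eval_simps)
    show ?case
      by (simp add: up_Var0) (intro iUniI iprov_dnegI X wf)
  next
    case 6
    have X: "prov \<Gamma> (Eq (times_tm (Var 1) (succ_tm (Var 0))) (plus_tm (times_tm (Var 1) (Var 0)) (Var 1)))" for \<Gamma>
      by (rule iprov_Uni_UniD, rule iAx, rule HA_axioms.intros) (simp_all add: eval_simps)
    show ?case
      by (simp add: up_Var0 up_up_Var1) (intro iUniI iprov_dnegI X [simplified] wf)
  next
    case (7 A)
    let ?A = "interp A (up \<rho>) (subst shift E)"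
    have wfA: "wf_fm arith ?A"
      using 7 assms(4) wf by (simp add: wf_interp wf_up)
    have step: "interp (msubst step A) (up \<rho>) (subst shift E) = subst step ?A"
      by (simp only: interp_msubst subst_interp comp_step subst_comp step_shift)
    have zero: "interp (msubst (inst zero_tm) A) \<rho> E = subst (inst zero_tm) ?A"
      by (simp add: interp_inst)
    \<comment> \<open>The induction formula is \<open>?A\<close>: instantiation at zero and the
      successor step both commute with the interpretation.\<close>
    have "interp (MImp (MCon (msubst (inst zero_tm) A) (MUni (MImp A (msubst step A)))) (MUni A)) \<rho> E
        \<in> HA_axioms"
      using HA_axioms.intros(7) [OF wfA] by (simp add: step zero)
    then show ?case
      using 7 assms(4,5) by (intro iAx wf_interp world_wf)
  qed
qed

theorem theorem2p3:
  fixes \<Sigma> :: "('f, 'p) signature"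
  shows "(\<forall>A :: ('f, 'p) fm. wf_fm \<Sigma> A \<longrightarrow> (IQC \<Sigma> A \<longleftrightarrow> EQC \<Sigma> (rs A))) \<and>
         (\<forall>A :: (arith_fun, unit) fm. wf_fm arith A \<longrightarrow> (HA A \<longleftrightarrow> EA (rs A)))"
proof (intro conjI allI impI)
  fix A :: "('f, 'p) fm" assume wf: "wf_fm \<Sigma> A"
  show "IQC \<Sigma> A \<longleftrightarrow> EQC \<Sigma> (rs A)"
    unfolding IQC_def EQC_def
  proof
    assume "iprov \<Sigma> {} {} A"
    then have "eprov \<Sigma> {} ((\<lambda>B. Box (rs B)) ` {}) (rs A)"
      by (rule rs_sound [rotated]) simp
    then show "eprov \<Sigma> {} {} (rs A)" by simp
  next
    assume "eprov \<Sigma> {} {} (rs A)"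
    with wf show "iprov \<Sigma> {} {} A"
      by (rule rs_faithful [rotated]) simp
  qed
next
  fix A :: "(arith_fun, unit) fm" assume wf: "wf_fm arith A"
  show "HA A \<longleftrightarrow> EA (rs A)"
    unfolding HA_def EA_def
  proof
    assume "iprov arith HA_axioms {} A"
    then have "eprov arith EA_axioms ((\<lambda>B. Box (rs B)) ` {}) (rs A)"
      by (rule rs_sound [rotated]) (rule HA_axiom_EA)
    then show "eprov arith EA_axioms {} (rs A)" by simp
  next
    assume "eprov arith EA_axioms {} (rs A)"
    with wf show "iprov arith HA_axioms {} A"
      by (rule rs_faithful [rotated]) (rule EA_axiom_HA)
  qed
qed

end
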